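(* For every instance $\mathbb I$ of matroid-APB, the commitment gap satisfies $\mathrm{CG}(\mathbb I)\le 2$.
   Context: Additive Pandora's Box (APB), minimization. There are $n$ additive boxes; box $i$ is $\mathcal B_i=(\vec{\mathcal D}_i,\vec c_i)$ with $k_i\ge1$ components: independent nonnegative random variables $V_{ij}\sim\mathcal D_{ij}$ (finite support) with probing costs $c_{ij}\ge0$, $j\in[k_i]$. Paying $c_{ij}$ reveals $V_{ij}$. Box $i$ can be selected only after all its components have been probed, at a cost $\sum_{j}V_{ij}$. Box $i$ is modeled as a costly information MDP (additive-MDP) whose states record which components have been probed and their realized values, whose actions at a state are "probe an unprobed component $j$" (cost $c_{ij}$), and whose terminal states are those in which all components are probed, with value equal to the sum of the realized values. Matroid-APB is matroid-min-CICS over these MDPs: given a matroid on $[n]$ and $\mathcal F$ the family of subsets containing a basis, a policy adaptively chooses a box and a component to probe, selects fully probed boxes, and stops when the selected set lies in $\mathcal F$; its cost is all probing costs plus the values of selected boxes; $\mathrm{OPT}(\mathbb I)$ is the minimum expected cost. A commitment for a box is a (possibly randomized) probing protocol fixed in advance that may depend only on that box's own realized components (an assignment to each state of a distribution over the available probes); a committing policy is any policy for the instance in which each box follows its commitment. $\mathrm{CG}(\mathbb I)$ is the minimum over tuples of commitments of the optimal expected cost of the restricted instance divided by $\mathrm{OPT}(\mathbb I)$. *)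

theory Defs
  imports "HOL-Probability.Probability"
begin

section \<open>Matroids\<close>

locale matroid =
  fixes carrier :: "'e set" and indep :: "'e set \<Rightarrow> bool"
  assumes carrier_finite: "finite carrier"
    and indep_subset_carrier: "indep X \<Longrightarrow> X \<subseteq> carrier"
    and indep_empty: "indep {}"
    and indep_subset: "indep X \<Longrightarrow> Y \<subseteq> X \<Longrightarrow> indep Y"
    and augment: "indep X \<Longrightarrow> indep Y \<Longrightarrow> card X < card Y \<Longrightarrow> \<exists>y\<in>Y - X. indep (insert y X)"

definition basis :: "('e set \<Rightarrow> bool) \<Rightarrow> 'e set \<Rightarrow> bool" where
  "basis indep X \<longleftrightarrow> indep X \<and> (\<forall>Y. indep Y \<longrightarrow> X \<subseteq> Y \<longrightarrow> Y = X)"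


section \<open>Costly information MDPs and combinatorial selection\<close>

record ('s, 'a) ci_mdp =
  mdp_states :: "'s set"
  mdp_init :: 's
  mdp_actions :: "'s \<Rightarrow> 'a set"
  mdp_cost :: "'s \<Rightarrow> 'a \<Rightarrow> real"
  mdp_step :: "'s \<Rightarrow> 'a \<Rightarrow> 's pmf"
  mdp_terminal :: "'s set"
  mdp_value :: "'s \<Rightarrow> real"

text \<open>A selection instance consists of \<open>num_boxes\<close> MDPs, indexed from 0, and a family of
  feasible index sets.\<close>

record ('s, 'a) cics =
  num_boxes :: nat
  mdp :: "nat \<Rightarrow> ('s, 'a) ci_mdp"
  feasible :: "nat set set"

datatype 'a move = Advance nat 'a | Select nat

text \<open>A configuration holds the current state of every MDP and the set selected so far.
  A history lists the moves made and the resulting configurations, latest first.\<close>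

type_synonym 's config = "(nat \<Rightarrow> 's) \<times> nat set"
type_synonym ('s, 'a) history = "('a move \<times> 's config) list"
type_synonym ('s, 'a) policy = "('s, 'a) history \<Rightarrow> 'a move pmf"

definition current :: "('s, 'a) cics \<Rightarrow> ('s, 'a) history \<Rightarrow> 's config" where
  "current I h = (case h of [] \<Rightarrow> (\<lambda>i. mdp_init (mdp I i), {}) | (m, g) # _ \<Rightarrow> g)"

definition finished :: "('s, 'a) cics \<Rightarrow> ('s, 'a) history \<Rightarrow> bool" where
  "finished I h \<longleftrightarrow> snd (current I h) \<in> feasible I"

definition available :: "('s, 'a) cics \<Rightarrow> 's config \<Rightarrow> 'a move set" where
  "available I = (\<lambda>(\<sigma>, S).
     {Advance i a |i a. i < num_boxes I \<and> a \<in> mdp_actions (mdp I i) (\<sigma> i)} \<union>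
     {Select i |i. i < num_boxes I \<and> i \<notin> S \<and> \<sigma> i \<in> mdp_terminal (mdp I i)})"

fun move_cost :: "('s, 'a) cics \<Rightarrow> 's config \<Rightarrow> 'a move \<Rightarrow> ennreal" where
  "move_cost I (\<sigma>, S) (Advance i a) = ennreal (mdp_cost (mdp I i) (\<sigma> i) a)"
| "move_cost I (\<sigma>, S) (Select i) = ennreal (mdp_value (mdp I i) (\<sigma> i))"

fun move_step :: "('s, 'a) cics \<Rightarrow> 's config \<Rightarrow> 'a move \<Rightarrow> 's config pmf" where
  "move_step I (\<sigma>, S) (Advance i a) =
     map_pmf (\<lambda>s. (\<sigma>(i := s), S)) (mdp_step (mdp I i) (\<sigma> i) a)"
| "move_step I (\<sigma>, S) (Select i) = return_pmf (\<sigma>, insert i S)"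

inductive_set histories :: "('s, 'a) cics \<Rightarrow> ('s, 'a) history set" for I :: "('s, 'a) cics" where
  Nil: "[] \<in> histories I"
| Cons: "h \<in> histories I \<Longrightarrow> \<not> finished I h \<Longrightarrow> m \<in> available I (current I h) \<Longrightarrow>
    g \<in> set_pmf (move_step I (current I h) m) \<Longrightarrow> (m, g) # h \<in> histories I"

definition policies :: "('s, 'a) cics \<Rightarrow> ('s, 'a) policy set" where
  "policies I = {\<pi>. \<forall>h\<in>histories I. \<not> finished I h \<longrightarrow>
     set_pmf (\<pi> h) \<subseteq> available I (current I h)}"

fun cost_upto :: "('s, 'a) cics \<Rightarrow> ('s, 'a) policy \<Rightarrow> nat \<Rightarrow> ('s, 'a) history \<Rightarrow> ennreal" where
  "cost_upto I \<pi> 0 h = 0"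
| "cost_upto I \<pi> (Suc N) h = (if finished I h then 0 else
     (\<integral>\<^sup>+ m. move_cost I (current I h) m +
        (\<integral>\<^sup>+ g. cost_upto I \<pi> N ((m, g) # h) \<partial>measure_pmf (move_step I (current I h) m))
      \<partial>measure_pmf (\<pi> h)))"

text \<open>The truncated costs increase to the total expected cost.  The supremum does not penalize
  a run that never reaches a feasible set, so it is the right objective only for MDPs of finite
  horizon.  For the additive MDPs below, every move probes a new component or selects a new box,
  and an unfinished history always has an available move, so every policy reaches a feasible
  set within a bounded number of moves.\<close>

definition expected_cost :: "('s, 'a) cics \<Rightarrow> ('s, 'a) policy \<Rightarrow> ennreal" where
  "expected_cost I \<pi> = (SUP N. cost_upto I \<pi> N [])"

definition opt :: "('s, 'a) cics \<Rightarrow> ennreal" where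
  "opt I = (INF \<pi>\<in>policies I. expected_cost I \<pi>)"


section \<open>Commitments\<close>

definition commitments :: "('s, 'a) cics \<Rightarrow> (nat \<Rightarrow> 's \<Rightarrow> 'a pmf) set" where
  "commitments I = {C. \<forall>i<num_boxes I. \<forall>s\<in>mdp_states (mdp I i) - mdp_terminal (mdp I i).
     set_pmf (C i s) \<subseteq> mdp_actions (mdp I i) s}"

text \<open>A committing policy only decides which box to advance or select (a \<open>unit move\<close>);
  the action inside an advanced box is drawn from the commitment of that box.\<close>

fun follow :: "(nat \<Rightarrow> 's \<Rightarrow> 'a pmf) \<Rightarrow> 's config \<Rightarrow> unit move \<Rightarrow> 'a move pmf" where
  "follow C (\<sigma>, S) (Advance i u) = map_pmf (Advance i) (C i (\<sigma> i))"
| "follow C (\<sigma>, S) (Select i) = return_pmf (Select i)"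

definition committing_policies ::
    "('s, 'a) cics \<Rightarrow> (nat \<Rightarrow> 's \<Rightarrow> 'a pmf) \<Rightarrow> ('s, 'a) policy set" where
  "committing_policies I C = {\<pi> \<in> policies I.
     \<exists>\<rho>. \<forall>h\<in>histories I. \<not> finished I h \<longrightarrow> \<pi> h = bind_pmf (\<rho> h) (follow C (current I h))}"

definition committed_opt :: "('s, 'a) cics \<Rightarrow> (nat \<Rightarrow> 's \<Rightarrow> 'a pmf) \<Rightarrow> ennreal" where
  "committed_opt I C = (INF \<pi>\<in>committing_policies I C. expected_cost I \<pi>)"

text \<open>In \<^typ>\<open>ennreal\<close>, \<open>0 / 0 = 0\<close> and \<open>x / 0 = \<infinity>\<close> for \<open>x > 0\<close>; hence, as \<open>opt I\<close> is finite,
  a bound on the gap remains a genuine bound on committed costs when \<open>opt I = 0\<close>.\<close>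

definition commitment_gap :: "('s, 'a) cics \<Rightarrow> ennreal" where
  "commitment_gap I = (INF C\<in>commitments I. committed_opt I C / opt I)"


section \<open>Additive Pandora's Box\<close>

record additive_box =
  num_components :: nat
  component_dist :: "nat \<Rightarrow> real pmf"
  probing_cost :: "nat \<Rightarrow> real"

definition valid_box :: "additive_box \<Rightarrow> bool" where
  "valid_box B \<longleftrightarrow> num_components B \<ge> 1 \<and> (\<forall>j<num_components B.
     finite (set_pmf (component_dist B j)) \<and> set_pmf (component_dist B j) \<subseteq> {0..} \<and>
     probing_cost B j \<ge> 0)"

text \<open>A state maps each probed component to its realized value.  Independence of the components
  is built in: a probe draws a fresh value whatever the current state.\<close>

definition additive_mdp :: "additive_box \<Rightarrow> (nat \<rightharpoonup> real, nat) ci_mdp" where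
  "additive_mdp B = \<lparr>
     mdp_states = {s. dom s \<subseteq> {..<num_components B} \<and>
       (\<forall>j\<in>dom s. the (s j) \<in> set_pmf (component_dist B j))},
     mdp_init = Map.empty,
     mdp_actions = (\<lambda>s. {..<num_components B} - dom s),
     mdp_cost = (\<lambda>s j. probing_cost B j),
     mdp_step = (\<lambda>s j. map_pmf (\<lambda>v. s(j \<mapsto> v)) (component_dist B j)),
     mdp_terminal = {s. dom s = {..<num_components B}},
     mdp_value = (\<lambda>s. \<Sum>j<num_components B. the (s j))\<rparr>"

definition matroid_apb ::
    "nat \<Rightarrow> (nat \<Rightarrow> additive_box) \<Rightarrow> (nat set \<Rightarrow> bool) \<Rightarrow> (nat \<rightharpoonup> real, nat) cics" where
  "matroid_apb n B indep = \<lparr>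
     num_boxes = n,
     mdp = (\<lambda>i. additive_mdp (B i)),
     feasible = {S. S \<subseteq> {..<n} \<and> (\<exists>X. basis indep X \<and> X \<subseteq> S)}\<rparr>"

end

theory Submission
  imports Defs
begin

text \<open>
  Let \<open>r\<^sub>i\<close> be the largest outside option at which box \<open>i\<close> is not worth opening, and let \<open>S\<^sub>i\<close> be
  the sum of its components.  By Weitzman's amortization argument the probing costs of box \<open>i\<close>
  pay for \<open>max 0 (r\<^sub>i - S\<^sub>i)\<close> whenever the box is fully probed, so every policy costs at least the
  expected weight of a cheapest basis for the weights \<open>max S\<^sub>i r\<^sub>i\<close>.

  For the upper bound, box \<open>i\<close> follows the probing strategy that is optimal for an outside option,
  its level, which starts at \<open>r\<^sub>i\<close> and is raised to the current reservation value whenever that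
  strategy would give up.  The reservation value of a partially probed box is the sum revealed so
  far plus the reservation value of the set of unprobed components, and the latter is monotone in
  the set; hence the level never exceeds \<open>S\<^sub>i + r\<^sub>i\<close>.  Always advancing the independent box of
  smallest level is greedy for the final levels and costs at most their cheapest basis.
  Finally \<open>S\<^sub>i + r\<^sub>i \<le> 2 * max S\<^sub>i r\<^sub>i\<close>.
\<close>

section \<open>Reservation values of an additive box\<close>

text \<open>\<open>x\<close> is the outside option minus the sum revealed so far, and \<open>R\<close> the set of unprobed
  components: additivity reduces the state of a box to these two parameters.  The value is the
  expected saving, compared with taking the outside option now, of probing at least once more.\<close>

function advantage :: "additive_box \<Rightarrow> nat set \<Rightarrow> real \<Rightarrow> real" where
  "advantage B R x = (if finite R \<and> R \<noteq> {} then
     MAX j\<in>R. measure_pmf.expectation (component_dist B j)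
       (\<lambda>v. max 0 (advantage B (R - {j}) (x - v))) - probing_cost B j
   else x)"
  by auto
termination
  by (relation "Wellfounded.measure (\<lambda>(B, R, x). card R)") (auto simp: card_gt_0_iff)

declare advantage.simps [simp del]

text \<open>The positive part adds the alternative of taking the outside option at once, which saves
  nothing; this is the value of the optimal stopping problem.\<close>

definition gain :: "additive_box \<Rightarrow> nat set \<Rightarrow> real \<Rightarrow> real" where
  "gain B R x = max 0 (advantage B R x)"

definition probe_value :: "additive_box \<Rightarrow> nat set \<Rightarrow> real \<Rightarrow> nat \<Rightarrow> real" where
  "probe_value B R x j =
     measure_pmf.expectation (component_dist B j) (\<lambda>v. gain B (R - {j}) (x - v)) - probing_cost B j"

definition best_probe :: "additive_box \<Rightarrow> nat set \<Rightarrow> real \<Rightarrow> nat" where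
  "best_probe B R x = (SOME j. j \<in> R \<and> probe_value B R x j = advantage B R x)"

text \<open>Weitzman's index for the unprobed set \<open>R\<close>. For a valid box the set is a
  closed half-line unbounded below, so its supremum is the largest outside option at which probing
  brings no gain.\<close>

definition reserve :: "additive_box \<Rightarrow> nat set \<Rightarrow> real" where
  "reserve B R = Sup {x. gain B R x \<le> 0}"

lemma advantage_empty [simp]: "advantage B {} x = x"
  by (simp add: advantage.simps)

lemma gain_nonneg: "gain B R x \<ge> 0"
  by (simp add: gain_def)

lemma advantage_eq_Max:
  assumes "finite R" "R \<noteq> {}"
  shows "advantage B R x = Max (probe_value B R x ` R)"
  using assms by (subst advantage.simps) (simp add: probe_value_def gain_def image_def)

lemma probe_value_le_advantage:
  assumes "finite R" "j \<in> R"
  shows "probe_value B R x j \<le> advantage B R x"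
  using assms by (subst advantage_eq_Max) auto

lemma best_probe:
  assumes "finite R" "R \<noteq> {}"
  shows "best_probe B R x \<in> R" "probe_value B R x (best_probe B R x) = advantage B R x"
proof -
  have "advantage B R x \<in> probe_value B R x ` R"
    using assms Max_in[of "probe_value B R x ` R"] by (simp add: advantage_eq_Max)
  then have "\<exists>j. j \<in> R \<and> probe_value B R x j = advantage B R x"
    by auto
  then have "best_probe B R x \<in> R \<and> probe_value B R x (best_probe B R x) = advantage B R x"
    unfolding best_probe_def by (rule someI_ex)
  then show "best_probe B R x \<in> R" "probe_value B R x (best_probe B R x) = advantage B R x"
    by auto
qed

lemma expectation_mono_finite:
  fixes p :: "'a pmf" and f g :: "'a \<Rightarrow> real"
  assumes "finite (set_pmf p)" "\<And>v. v \<in> set_pmf p \<Longrightarrow> f v \<le> g v"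
  shows "measure_pmf.expectation p f \<le> measure_pmf.expectation p g"
  using assms
  by (intro integral_mono_AE) (auto simp: AE_measure_pmf_iff integrable_measure_pmf_finite)

section \<open>The gain as a function of the outside option and of the unprobed set\<close>

locale component_box =
  fixes B :: additive_box
  assumes valid: "valid_box B"
begin

abbreviation "parts \<equiv> {..<num_components B}"

lemma component_support:
  assumes "j \<in> parts"
  shows "finite (set_pmf (component_dist B j))" "v \<in> set_pmf (component_dist B j) \<Longrightarrow> v \<ge> 0"
  using assms valid unfolding valid_box_def by auto

lemma probing_cost_nonneg: "j \<in> parts \<Longrightarrow> probing_cost B j \<ge> 0"
  using valid unfolding valid_box_def by auto

lemma integrable_component:
  assumes "j \<in> parts"
  shows "integrable (measure_pmf (component_dist B j)) (f :: real \<Rightarrow> real)"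
  using component_support(1)[OF assms] by (rule integrable_measure_pmf_finite)

text \<open>Translation of the argument, positive part, expectation and maximum over
  \<open>j\<close> all preserve monotonicity and the Lipschitz constant 1, so both pass through the
  recursion of \<open>advantage\<close>.\<close>

lemma advantage_mono_Lipschitz:
  assumes "R \<subseteq> parts" "x \<le> y"
  shows "advantage B R x \<le> advantage B R y \<and> advantage B R y \<le> advantage B R x + (y - x)"
proof -
  have "finite R" using assms(1) finite_subset by blast
  then show ?thesis
    using assms
  proof (induction R arbitrary: x y rule: finite_psubset_induct)
    case (psubset R)
    show ?case
    proof (cases "R = {}")
      case False
      have step: "probe_value B R x j \<le> probe_value B R y j \<and>
          probe_value B R y j \<le> probe_value B R x j + (y - x)" if j: "j \<in> R" for j
      proof -
        have jc: "j \<in> parts" using j psubset.prems by auto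
        note int = integrable_component[OF jc] and fin = component_support(1)[OF jc]
        have *: "advantage B (R - {j}) (x - v) \<le> advantage B (R - {j}) (y - v) \<and>
          advantage B (R - {j}) (y - v) \<le> advantage B (R - {j}) (x - v) + (y - x)" for v
          using psubset.IH[of "R - {j}" "x - v" "y - v"] psubset.prems j by auto
        have "gain B (R - {j}) (x - v) \<le> gain B (R - {j}) (y - v)"
          and "gain B (R - {j}) (y - v) \<le> gain B (R - {j}) (x - v) + (y - x)" for v
          using *[of v] psubset.prems(2) by (auto simp: gain_def)
        then have
          "measure_pmf.expectation (component_dist B j) (\<lambda>v. gain B (R - {j}) (x - v))
            \<le> measure_pmf.expectation (component_dist B j) (\<lambda>v. gain B (R - {j}) (y - v))"
          "measure_pmf.expectation (component_dist B j) (\<lambda>v. gain B (R - {j}) (y - v))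
            \<le> measure_pmf.expectation (component_dist B j) (\<lambda>v. gain B (R - {j}) (x - v) + (y - x))"
          by (intro expectation_mono_finite fin; simp)+
        then show ?thesis
          using int by (simp add: probe_value_def)
      qed
      have "advantage B R x \<le> advantage B R y"
        using best_probe[OF psubset.hyps False, of B x]
          step[of "best_probe B R x"] probe_value_le_advantage[OF psubset.hyps, of "best_probe B R x" B y]
        by auto
      moreover have "advantage B R y \<le> advantage B R x + (y - x)"
        using best_probe[OF psubset.hyps False, of B y]
          step[of "best_probe B R y"] probe_value_le_advantage[OF psubset.hyps, of "best_probe B R y" B x]
        by auto
      ultimately show ?thesis by blast
    qed (use psubset.prems in auto)
  qed
qed

lemma gain_mono: "R \<subseteq> parts \<Longrightarrow> x \<le> y \<Longrightarrow> gain B R x \<le> gain B R y"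
  using advantage_mono_Lipschitz[of R x y] by (auto simp: gain_def)

lemma gain_Lipschitz: "R \<subseteq> parts \<Longrightarrow> x \<le> y \<Longrightarrow> gain B R y \<le> gain B R x + (y - x)"
  using advantage_mono_Lipschitz[of R x y] by (auto simp: gain_def)

text \<open>Imitation: with \<open>j\<close> gone, follow the best strategy for \<open>R\<close> and
  treat \<open>j\<close> as probed at no cost with value 0. If \<open>j\<close> is its first probe,
  the nonnegative value and cost of \<open>j\<close> are saved; otherwise induction applies after
  the first probe.\<close>

lemma gain_remove:
  assumes "R \<subseteq> parts" "j \<in> R"
  shows "gain B R x \<le> gain B (R - {j}) x"
proof -
  have "finite R" using assms(1) finite_subset by blast
  then show ?thesis
    using assms
  proof (induction R arbitrary: x rule: finite_psubset_induct)
    case (psubset R)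
    have "R \<noteq> {}" using psubset.prems by auto
    define k where "k = best_probe B R x"
    have k: "k \<in> R" "advantage B R x = probe_value B R x k"
      using best_probe[OF psubset.hyps \<open>R \<noteq> {}\<close>, of B x] by (auto simp: k_def)
    have kc: "k \<in> parts" using k psubset.prems by auto
    note fin = component_support(1)[OF kc]
    have "probe_value B R x k \<le> gain B (R - {j}) x"
    proof (cases "k = j")
      case True
      have "measure_pmf.expectation (component_dist B k) (\<lambda>v. gain B (R - {k}) (x - v))
          \<le> measure_pmf.expectation (component_dist B k) (\<lambda>v. gain B (R - {k}) x)"
        using component_support(2)[OF kc] psubset.prems
        by (intro expectation_mono_finite fin gain_mono) auto
      then show ?thesis
        using probing_cost_nonneg[OF kc] True by (simp add: probe_value_def)
    next
      case False
      have "gain B (R - {k}) (x - v) \<le> gain B (R - {j} - {k}) (x - v)" for v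
      proof -
        have "R - {j} - {k} = R - {k} - {j}" by auto
        then show ?thesis
          using psubset.IH[of "R - {k}" "x - v"] k psubset.prems False by auto
      qed
      then have "probe_value B R x k \<le> probe_value B (R - {j}) x k"
        unfolding probe_value_def by (intro diff_right_mono expectation_mono_finite fin)
      also have "\<dots> \<le> advantage B (R - {j}) x"
        using k False psubset.hyps by (intro probe_value_le_advantage) auto
      finally show ?thesis by (simp add: gain_def)
    qed
    then show ?case
      using k gain_nonneg[of B "R - {j}" x] by (simp add: gain_def)
  qed
qed

lemma gain_antimono:
  assumes "R \<subseteq> parts" "R' \<subseteq> R"
  shows "gain B R x \<le> gain B R' x"
proof -
  have "finite (R - R')" using assms finite_subset by blast
  then show ?thesis
    using assms
  proof (induction "R - R'" arbitrary: R rule: finite_induct)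
    case (insert j F)
    then have "j \<in> R" by auto
    then have "gain B R x \<le> gain B (R - {j}) x"
      using gain_remove insert by auto
    also have "\<dots> \<le> gain B R' x"
      using insert by (intro insert.hyps(3)) auto
    finally show ?case .
  qed (simp add: subset_antisym)
qed

lemma gain_le: "R \<subseteq> parts \<Longrightarrow> gain B R x \<le> max 0 x"
  using gain_antimono[of R "{}" x] by (simp add: gain_def)

text \<open>Probing everything and then taking the box saves \<open>x - t\<close> on average, where
  \<open>t\<close> is the expected sum plus all probing costs of \<open>R\<close>. This bounds the
  set behind \<open>reserve\<close>.\<close>

lemma gain_lower_bound:
  assumes "R \<subseteq> parts"
  shows "\<exists>t. \<forall>x. x - t \<le> gain B R x"
proof -
  have "finite R" using assms finite_subset by blast
  then show ?thesis
    using assms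
  proof (induction R rule: finite_induct)
    case empty
    show ?case by (rule exI[of _ 0]) (simp add: gain_def)
  next
    case (insert j R)
    then obtain t where t: "\<And>x. x - t \<le> gain B R x" by auto
    have jc: "j \<in> parts" using insert by auto
    note int = integrable_component[OF jc]
    let ?m = "measure_pmf.expectation (component_dist B j) (\<lambda>v. v)"
    have "x - (t + ?m + probing_cost B j) \<le> gain B (insert j R) x" for x
    proof -
      have "x - t - ?m = measure_pmf.expectation (component_dist B j) (\<lambda>v. x - v - t)"
        using int by simp
      also have "\<dots> \<le> measure_pmf.expectation (component_dist B j) (\<lambda>v. gain B R (x - v))"
        by (intro expectation_mono_finite component_support(1)[OF jc] t)
      finally have "x - (t + ?m + probing_cost B j) \<le> probe_value B (insert j R) x j"
        using insert.hyps by (simp add: probe_value_def)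
      also have "\<dots> \<le> advantage B (insert j R) x"
        using insert.hyps by (intro probe_value_le_advantage) auto
      finally show ?thesis by (simp add: gain_def)
    qed
    then show ?case by blast
  qed
qed

section \<open>The reservation value as the largest zero of the gain\<close>

lemma le_reserve:
  assumes "R \<subseteq> parts" "gain B R x = 0"
  shows "x \<le> reserve B R"
  unfolding reserve_def
proof (rule cSup_upper)
  obtain t where "\<And>x. x - t \<le> gain B R x"
    using gain_lower_bound[OF assms(1)] by blast
  then show "bdd_above {x. gain B R x \<le> 0}"
    by (intro bdd_aboveI[of _ t]) (smt (verit) mem_Collect_eq)
qed (use assms in auto)

lemma reserve_nonneg:
  assumes "R \<subseteq> parts"
  shows "reserve B R \<ge> 0"
  using le_reserve[OF assms, of 0] gain_le[OF assms, of 0] gain_nonneg[of B R 0] by auto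

text \<open>The supremum is attained because the gain is continuous: a zero within \<open>e\<close>
  of it bounds the gain there by \<open>e\<close> through the Lipschitz estimate.\<close>

lemma gain_reserve:
  assumes "R \<subseteq> parts"
  shows "gain B R (reserve B R) = 0"
proof -
  have "gain B R (reserve B R) \<le> 0 + e" if "e > 0" for e
  proof -
    have "{x. gain B R x \<le> 0} \<noteq> {}"
      using gain_le[OF assms, of 0] by auto
    then obtain x where "gain B R x \<le> 0" "reserve B R - e < x"
      using less_cSupD[of "{x. gain B R x \<le> 0}" "reserve B R - e"] \<open>e > 0\<close>
      by (auto simp: reserve_def)
    then show ?thesis
      using gain_Lipschitz[OF assms, of x "reserve B R"] gain_mono[OF assms, of "reserve B R" x]
        \<open>e > 0\<close>
      by (cases "x \<le> reserve B R") auto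
  qed
  then have "gain B R (reserve B R) \<le> 0" by (rule field_le_epsilon)
  then show ?thesis using gain_nonneg by (simp add: antisym)
qed

text \<open>Slightly above the reservation value the gain is positive, hence so is the advantage,
  and continuity carries the sign to the limit. With \<open>gain_reserve\<close> the advantage there
  is exactly 0: probing and stopping are equally good.\<close>

lemma advantage_reserve_nonneg:
  assumes "R \<subseteq> parts"
  shows "advantage B R (reserve B R) \<ge> 0"
proof -
  have "0 \<le> advantage B R (reserve B R) + e" if "e > 0" for e
  proof -
    have "gain B R (reserve B R + e) \<noteq> 0"
      using le_reserve[OF assms, of "reserve B R + e"] \<open>e > 0\<close> by auto
    then have "advantage B R (reserve B R + e) > 0"
      by (auto simp: gain_def max_def split: if_splits)
    then show ?thesis
      using advantage_mono_Lipschitz[OF assms, of "reserve B R" "reserve B R + e"] \<open>e > 0\<close> by auto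
  qed
  then show ?thesis by (rule field_le_epsilon)
qed

text \<open>With fewer unprobed components the gain is no smaller, so a zero of the gain for
  \<open>R'\<close> is one for \<open>R\<close>. The upper bound on the final level rests on
  this.\<close>

lemma reserve_mono:
  assumes "R \<subseteq> parts" "R' \<subseteq> R"
  shows "reserve B R' \<le> reserve B R"
proof (rule le_reserve[OF assms(1)])
  have "gain B R (reserve B R') \<le> gain B R' (reserve B R')"
    by (rule gain_antimono[OF assms])
  then show "gain B R (reserve B R') = 0"
    using gain_reserve[of R'] gain_nonneg[of B R "reserve B R'"] assms by auto
qed

end

section \<open>The commitment of a box\<close>

text \<open>At a negative advantage the strategy would stop. The reservation value is a budget at
  which continuing is optimal, and the gain is 0 before and after the change.\<close>

definition raise :: "additive_box \<Rightarrow> nat set \<Rightarrow> real \<Rightarrow> real" where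
  "raise B R x = (if advantage B R x < 0 then reserve B R else x)"

text \<open>A commitment may only depend on the set of revealed values, whereas the budget depends on the
  order of the probes.  As the strategy is deterministic, \<open>replay\<close> recovers this order from the
  revealed values.  On states that the strategy cannot reach it stops at the first component that
  should have been probed.\<close>

function replay :: "additive_box \<Rightarrow> (nat \<rightharpoonup> real) \<Rightarrow> nat set \<Rightarrow> real \<Rightarrow> nat set \<times> real" where
  "replay B s R x = (if finite R \<and> R \<noteq> {} then
     (case s (best_probe B R x) of
        None \<Rightarrow> (R, x)
      | Some v \<Rightarrow> replay B s (R - {best_probe B R x}) (raise B (R - {best_probe B R x}) (x - v)))
   else (R, x))"
  by auto
termination
  by (relation "Wellfounded.measure (\<lambda>(B, s, R, x). card R)")
    (auto simp: card_gt_0_iff best_probe card_Diff_singleton)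

declare replay.simps [simp del]

definition run_state :: "additive_box \<Rightarrow> (nat \<rightharpoonup> real) \<Rightarrow> nat set \<times> real" where
  "run_state B s = replay B s {..<num_components B} (reserve B {..<num_components B})"

definition committed_probe :: "additive_box \<Rightarrow> (nat \<rightharpoonup> real) \<Rightarrow> nat" where
  "committed_probe B s = best_probe B (fst (run_state B s)) (snd (run_state B s))"

text \<open>The budget is net of the values consumed by the replay; adding them back gives the
  outside option against which the whole box is weighed.\<close>

definition level :: "additive_box \<Rightarrow> (nat \<rightharpoonup> real) \<Rightarrow> real" where
  "level B s = snd (run_state B s) + (\<Sum>j\<in>{..<num_components B} - fst (run_state B s). the (s j))"

text \<open>An account into which the probing costs go: it starts at 0, grows on average by the cost
  of each committed probe, and ends as the level minus the sum of the box.\<close>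

definition pending :: "additive_box \<Rightarrow> (nat \<rightharpoonup> real) \<Rightarrow> real" where
  "pending B s = gain B (fst (run_state B s)) (snd (run_state B s))"

definition on_track :: "additive_box \<Rightarrow> (nat \<rightharpoonup> real) \<Rightarrow> bool" where
  "on_track B s \<longleftrightarrow> dom s \<subseteq> {..<num_components B} \<and>
     fst (run_state B s) = {..<num_components B} - dom s"

definition total :: "(nat \<rightharpoonup> real) \<Rightarrow> real" where
  "total s = (\<Sum>j\<in>dom s. the (s j))"

section \<open>Recovering the run from the revealed values\<close>

lemma pending_nonneg: "pending B s \<ge> 0"
  by (simp add: pending_def gain_nonneg)

text \<open>The last clause makes the commitment legal even on states that it never reaches: the
  component at which the replay gets stuck is unprobed.\<close>

lemma replay_subset:
  assumes "finite R"
  shows "fst (replay B s R x) \<subseteq> R" "R - fst (replay B s R x) \<subseteq> dom s"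
    "fst (replay B s R x) \<noteq> {} \<Longrightarrow>
      s (best_probe B (fst (replay B s R x)) (snd (replay B s R x))) = None"
proof -
  have "fst (replay B s R x) \<subseteq> R \<and> R - fst (replay B s R x) \<subseteq> dom s \<and>
     (fst (replay B s R x) \<noteq> {} \<longrightarrow>
      s (best_probe B (fst (replay B s R x)) (snd (replay B s R x))) = None)"
    using assms
  proof (induction B s R x rule: replay.induct)
    case (1 B s R x)
    show ?case
    proof (cases "R = {} \<or> s (best_probe B R x) = None")
      case True
      then show ?thesis by (subst (1 2 3 4 5) replay.simps) auto
    next
      case False
      then obtain v where v: "s (best_probe B R x) = Some v" by auto
      have eq: "replay B s R x =
          replay B s (R - {best_probe B R x}) (raise B (R - {best_probe B R x}) (x - v))"
        using False v 1 by (subst replay.simps) auto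
      show ?thesis
        unfolding eq using "1.IH"[OF _ v] "1.prems" False v by blast
    qed
  qed
  then show "fst (replay B s R x) \<subseteq> R" "R - fst (replay B s R x) \<subseteq> dom s"
    "fst (replay B s R x) \<noteq> {} \<Longrightarrow>
      s (best_probe B (fst (replay B s R x)) (snd (replay B s R x))) = None"
    by auto
qed

text \<open>The strategy is deterministic, so additional values come into play only once the replay
  on \<open>s\<close> has stopped, and the replay on \<open>s'\<close> passes through the same
  pair.\<close>

lemma replay_extend:
  assumes "finite R" "s \<subseteq>\<^sub>m s'"
  shows "replay B s' R x = replay B s' (fst (replay B s R x)) (snd (replay B s R x))"
  using assms
proof (induction B s R x rule: replay.induct)
  case (1 B s R x)
  show ?case
  proof (cases "R = {} \<or> s (best_probe B R x) = None")
    case True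
    then have "replay B s R x = (R, x)" by (subst replay.simps) auto
    then show ?thesis by simp
  next
    case False
    then obtain v where v: "s (best_probe B R x) = Some v" by auto
    then have v': "s' (best_probe B R x) = Some v"
      using "1.prems" by (metis domI map_le_def)
    let ?j = "best_probe B R x"
    have eq: "replay B s R x = replay B s (R - {?j}) (raise B (R - {?j}) (x - v))"
      using False v 1 by (subst replay.simps) auto
    have "replay B s' R x = replay B s' (R - {?j}) (raise B (R - {?j}) (x - v))"
      using False v' 1 by (subst replay.simps) auto
    then show ?thesis
      unfolding eq using "1.IH"[OF _ v] "1.prems" False by auto
  qed
qed

lemma replay_step:
  assumes "finite R" "replay B s R x = (R', x')" "R' \<noteq> {}" "R' \<inter> dom s = {}"
    and "j = best_probe B R' x'"
  shows "replay B (s(j \<mapsto> v)) R x = (R' - {j}, raise B (R' - {j}) (x' - v))"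
proof -
  have fin: "finite R'" using replay_subset(1)[OF assms(1), of B s x] assms finite_subset by fastforce
  have j: "j \<in> R'" using best_probe fin assms by auto
  have "s \<subseteq>\<^sub>m s(j \<mapsto> v)"
    using j assms by (auto simp: map_le_def)
  then have "replay B (s(j \<mapsto> v)) R x = replay B (s(j \<mapsto> v)) R' x'"
    using replay_extend[OF assms(1), of s "s(j \<mapsto> v)" B x] assms(2) by simp
  also have "\<dots> = replay B (s(j \<mapsto> v)) (R' - {j}) (raise B (R' - {j}) (x' - v))"
    using assms fin by (subst replay.simps) auto
  also have "\<dots> = (R' - {j}, raise B (R' - {j}) (x' - v))"
  proof (cases "R' - {j} = {}")
    case False
    let ?k = "best_probe B (R' - {j}) (raise B (R' - {j}) (x' - v))"
    have "?k \<in> R' - {j}" by (rule best_probe(1)) (use False fin in simp_all)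
    then have "?k \<noteq> j" "?k \<notin> dom s" using assms(4) by blast+
    then have "(s(j \<mapsto> v)) ?k = None" by (simp add: domIff)
    then show ?thesis by (subst replay.simps) simp
  qed (subst replay.simps, simp)
  finally show ?thesis .
qed

section \<open>Invariants of budget, level and pending gain\<close>

context component_box
begin

lemma le_raise: "R \<subseteq> parts \<Longrightarrow> x \<le> raise B R x"
  using le_reserve[of R x] by (auto simp: raise_def gain_def)

lemma advantage_raise_nonneg: "R \<subseteq> parts \<Longrightarrow> advantage B R (raise B R x) \<ge> 0"
  using advantage_reserve_nonneg[of R] by (auto simp: raise_def)

lemma gain_raise: "R \<subseteq> parts \<Longrightarrow> gain B R (raise B R x) = gain B R x"
  using gain_reserve[of R] by (auto simp: raise_def) (simp add: gain_def)

lemma raise_pos: "R \<subseteq> parts \<Longrightarrow> gain B R (raise B R x) > 0 \<Longrightarrow> raise B R x = x"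
  using gain_reserve[of R] by (auto simp: raise_def split: if_splits)

text \<open>\<open>raise\<close> restores a nonnegative advantage after each probe. It never lowers
  the budget, and each consumed value moves from the budget into the sum, so the two together cannot
  fall.\<close>

lemma replay_budget:
  assumes "R \<subseteq> parts" "advantage B R x \<ge> 0"
  shows "advantage B (fst (replay B s R x)) (snd (replay B s R x)) \<ge> 0"
    and "x \<le> snd (replay B s R x) + (\<Sum>j\<in>R - fst (replay B s R x). the (s j))"
proof -
  have "advantage B (fst (replay B s R x)) (snd (replay B s R x)) \<ge> 0 \<and>
    x \<le> snd (replay B s R x) + (\<Sum>j\<in>R - fst (replay B s R x). the (s j))"
    using assms
  proof (induction "card R" arbitrary: R x rule: less_induct)
    case (less R x)
    have fin: "finite R" using less finite_subset by blast
    show ?case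
    proof (cases "R = {} \<or> s (best_probe B R x) = None")
      case True
      then have "replay B s R x = (R, x)" by (subst replay.simps) auto
      then show ?thesis using less by simp
    next
      case False
      then obtain v where v: "s (best_probe B R x) = Some v" by auto
      define j where "j = best_probe B R x"
      define y where "y = raise B (R - {j}) (x - v)"
      have jR: "j \<in> R" using best_probe False fin by (auto simp: j_def)
      have eq: "replay B s R x = replay B s (R - {j}) y"
        using False v fin by (subst replay.simps) (auto simp: j_def y_def)
      have sub: "R - {j} \<subseteq> parts" using less by auto
      have IH: "advantage B (fst (replay B s (R - {j}) y)) (snd (replay B s (R - {j}) y)) \<ge> 0 \<and>
        y \<le> snd (replay B s (R - {j}) y) + (\<Sum>j\<in>R - {j} - fst (replay B s (R - {j}) y). the (s j))"
        using sub jR fin advantage_raise_nonneg[OF sub]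
        by (intro less.hyps card_Diff1_less) (auto simp: y_def)
      let ?F = "fst (replay B s (R - {j}) y)"
      have "?F \<subseteq> R - {j}" using replay_subset(1) fin by blast
      then have "R - ?F = insert j (R - {j} - ?F)" using jR by auto
      then have "(\<Sum>j\<in>R - ?F. the (s j)) = v + (\<Sum>j\<in>R - {j} - ?F. the (s j))"
        using fin v by (simp add: j_def)
      moreover have "x - v \<le> y" using le_raise[OF sub] by (simp add: y_def)
      ultimately show ?thesis unfolding eq using IH by auto
    qed
  qed
  then show "advantage B (fst (replay B s R x)) (snd (replay B s R x)) \<ge> 0"
    "x \<le> snd (replay B s R x) + (\<Sum>j\<in>R - fst (replay B s R x). the (s j))" by auto
qed

text \<open>A nonnegative value lowers the budget or keeps it; a raise sets it to the reservation
  value of a smaller set, which \<open>reserve_mono\<close> bounds by that of the whole box.\<close>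

lemma replay_le_reserve:
  assumes "R \<subseteq> parts" "x \<le> reserve B parts" "\<And>j. j \<in> dom s \<Longrightarrow> the (s j) \<ge> 0"
  shows "snd (replay B s R x) \<le> reserve B parts"
  using assms(1,2)
proof (induction "card R" arbitrary: R x rule: less_induct)
  case (less R x)
  have fin: "finite R" using less finite_subset by blast
  show ?case
  proof (cases "R = {} \<or> s (best_probe B R x) = None")
    case True
    then have "replay B s R x = (R, x)" by (subst replay.simps) auto
    then show ?thesis using less by simp
  next
    case False
    then obtain v where v: "s (best_probe B R x) = Some v" by auto
    define j where "j = best_probe B R x"
    have jR: "j \<in> R" using best_probe False fin by (auto simp: j_def)
    have "v \<ge> 0" using assms(3)[of "best_probe B R x"] v by auto
    then have "raise B (R - {j}) (x - v) \<le> reserve B parts"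
      using reserve_mono[of parts "R - {j}"] less.prems by (auto simp: raise_def)
    moreover have "replay B s R x = replay B s (R - {j}) (raise B (R - {j}) (x - v))"
      using False v fin by (subst replay.simps) (auto simp: j_def)
    ultimately show ?thesis
      using less jR fin by (metis Diff_subset card_Diff1_less order_trans)
  qed
qed

lemma run_state_subset: "fst (run_state B s) \<subseteq> parts"
  by (simp add: run_state_def replay_subset)

lemma committed_probe_unprobed:
  assumes "dom s \<subset> parts"
  shows "committed_probe B s \<in> parts - dom s"
proof -
  have "fst (run_state B s) \<noteq> {}"
    using replay_subset(2)[of parts B s "reserve B parts"] assms by (auto simp: run_state_def)
  then have "s (committed_probe B s) = None"
    using replay_subset(3)[of parts B s] unfolding committed_probe_def run_state_def by simp
  moreover have "committed_probe B s \<in> fst (run_state B s)"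
    using \<open>fst (run_state B s) \<noteq> {}\<close> run_state_subset[of s] finite_subset
    unfolding committed_probe_def by (intro best_probe) auto
  ultimately show ?thesis using run_state_subset[of s] by auto
qed

text \<open>With every value at hand the replay cannot get stuck, whatever the order of the actual
  probes. Hence every completion of a configuration has a meaningful final level.\<close>

lemma on_track_full:
  assumes "dom s = parts"
  shows "on_track B s"
proof -
  have "fst (run_state B s) = {}"
  proof (rule ccontr)
    assume ne: "fst (run_state B s) \<noteq> {}"
    then have "s (committed_probe B s) = None"
      using replay_subset(3)[of parts B s] unfolding committed_probe_def run_state_def by simp
    moreover have "committed_probe B s \<in> fst (run_state B s)"
      using ne run_state_subset[of s] finite_subset
      unfolding committed_probe_def by (intro best_probe) auto
    ultimately show False using run_state_subset[of s] assms by auto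
  qed
  then show ?thesis using assms by (simp add: on_track_def)
qed

lemma run_state_empty: "run_state B Map.empty = (parts, reserve B parts)"
  by (simp add: run_state_def replay.simps)

lemma on_track_empty: "on_track B Map.empty"
  by (simp add: on_track_def run_state_empty)

lemma pending_empty: "pending B Map.empty = 0"
  by (simp add: pending_def run_state_empty gain_reserve)

lemma advantage_run_state: "advantage B (fst (run_state B s)) (snd (run_state B s)) \<ge> 0"
  unfolding run_state_def by (intro replay_budget advantage_reserve_nonneg) auto

lemma run_state_step:
  assumes "on_track B s" "dom s \<noteq> parts" "j = committed_probe B s"
  shows "run_state B (s(j \<mapsto> v)) = (fst (run_state B s) - {j},
    raise B (fst (run_state B s) - {j}) (snd (run_state B s) - v))"
  using replay_step[of parts B s "reserve B parts" "fst (run_state B s)" "snd (run_state B s)" j v] assms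
  by (auto simp: on_track_def committed_probe_def run_state_def)

lemma on_track_step:
  assumes "on_track B s" "dom s \<noteq> parts"
  shows "on_track B (s(committed_probe B s \<mapsto> v))"
proof -
  have "committed_probe B s \<in> parts - dom s"
    using assms by (intro committed_probe_unprobed) (auto simp: on_track_def)
  then show ?thesis
    using run_state_step[OF assms refl, of v] assms(1) by (auto simp: on_track_def)
qed

lemma level_on_track: "on_track B s \<Longrightarrow> level B s = snd (run_state B s) + total s"
  by (auto simp: on_track_def level_def total_def intro!: sum.cong)

lemma total_update:
  assumes "finite (dom s)" "j \<notin> dom s"
  shows "total (s(j \<mapsto> v)) = total s + v"
proof -
  have "(\<Sum>i\<in>dom s. the ((s(j \<mapsto> v)) i)) = (\<Sum>i\<in>dom s. the (s i))"
    using assms by (intro sum.cong) auto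
  then show ?thesis using assms by (simp add: total_def)
qed

text \<open>The advantage at the current budget is nonnegative, so the gain equals the value of the
  best probe, which is the committed one. A raise after the probe leaves the gain unchanged.\<close>

lemma pending_step:
  assumes "on_track B s" "dom s \<noteq> parts" "j = committed_probe B s"
  shows "measure_pmf.expectation (component_dist B j) (\<lambda>v. pending B (s(j \<mapsto> v))) =
    pending B s + probing_cost B j"
proof -
  define R x where "R = fst (run_state B s)" and "x = snd (run_state B s)"
  have R: "R \<subseteq> parts" using run_state_subset by (simp add: R_def)
  have ne: "finite R" "R \<noteq> {}" using assms finite_subset[OF R] by (auto simp: R_def on_track_def)
  have "pending B (s(j \<mapsto> v)) = gain B (R - {j}) (x - v)" for v
    using gain_raise[of "R - {j}" "x - v"] R
    by (auto simp: pending_def run_state_step[OF assms] R_def x_def)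
  moreover have "pending B s = probe_value B R x j"
    using best_probe(2)[OF ne, of B x] advantage_run_state[of s] assms(3)
    by (simp add: pending_def gain_def committed_probe_def R_def x_def)
  ultimately show ?thesis by (simp add: probe_value_def)
qed

text \<open>A positive gain rules out a raise, so \<open>v\<close> only moves from the budget to the
  sum.\<close>

lemma level_step:
  assumes "on_track B s" "dom s \<noteq> parts" "j = committed_probe B s"
    and "pending B (s(j \<mapsto> v)) > 0"
  shows "level B (s(j \<mapsto> v)) = level B s"
proof -
  have j: "j \<in> parts - dom s"
    using assms by (metis committed_probe_unprobed on_track_def psubsetI)
  have "finite (dom s)" using assms(1) finite_subset by (auto simp: on_track_def)
  have sub: "fst (run_state B s) - {j} \<subseteq> parts" using run_state_subset[of s] by auto
  have "snd (run_state B (s(j \<mapsto> v))) = snd (run_state B s) - v"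
    using raise_pos[OF sub] assms(4) by (simp add: pending_def run_state_step[OF assms(1-3)])
  then show ?thesis
    using level_on_track[OF assms(1)] level_on_track[OF on_track_step[OF assms(1,2)], of v]
      total_update[OF \<open>finite (dom s)\<close>, of j v] j assms(3) by simp
qed

text \<open>The state \<open>s'\<close> may have been probed in any order: its replay passes through
  the pair of \<open>s\<close>, and from there the budget plus the consumed values does not
  fall.\<close>

lemma level_mono:
  assumes "on_track B s" "s \<subseteq>\<^sub>m s'"
  shows "level B s \<le> level B s'"
proof -
  define R x where "R = fst (run_state B s)" and "x = snd (run_state B s)"
  have R: "R \<subseteq> parts" using run_state_subset by (simp add: R_def)
  have s': "run_state B s' = replay B s' R x"
    using replay_extend[of parts s s'] assms(2) by (simp add: run_state_def R_def x_def)
  let ?F = "fst (replay B s' R x)"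
  have "?F \<subseteq> R" using replay_subset(1) R finite_subset by (metis finite_lessThan)
  have "level B s' = snd (replay B s' R x) + (\<Sum>j\<in>(parts - R) \<union> (R - ?F). the (s' j))"
    unfolding level_def s' using R \<open>?F \<subseteq> R\<close> by (intro arg_cong2[of _ _ _ _ "(+)"] sum.cong) auto
  also have "\<dots> = snd (replay B s' R x) + (\<Sum>j\<in>R - ?F. the (s' j)) + (\<Sum>j\<in>parts - R. the (s' j))"
    using finite_subset[OF R] by (subst sum.union_disjoint) auto
  also have "(\<Sum>j\<in>parts - R. the (s' j)) = (\<Sum>j\<in>parts - R. the (s j))"
    using assms by (intro sum.cong) (auto simp: on_track_def R_def map_le_def)
  finally show ?thesis
    using replay_budget(2)[OF R, of x s'] advantage_run_state[of s] by (simp add: level_def R_def x_def)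
qed

lemma level_nonneg: "level B s \<ge> 0"
  using level_mono[OF on_track_empty, of s] reserve_nonneg[of parts]
  by (simp add: level_def run_state_empty map_le_empty)

lemma level_le:
  assumes "dom s = parts" "\<And>j. j \<in> dom s \<Longrightarrow> the (s j) \<ge> 0"
  shows "level B s \<le> total s + reserve B parts"
  using level_on_track[OF on_track_full[OF assms(1)]]
    replay_le_reserve[of parts "reserve B parts" s] assms(2) by (auto simp: run_state_def)

text \<open>With nothing left to probe, the nonnegative advantage is the budget itself, so the
  positive part drops out.\<close>

lemma pending_full:
  assumes "dom s = parts"
  shows "pending B s = level B s - total s"
proof -
  have "fst (run_state B s) = {}"
    using on_track_full[OF assms] assms by (simp add: on_track_def)
  then show ?thesis
    using advantage_run_state[of s] level_on_track[OF on_track_full[OF assms]]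
    by (simp add: pending_def gain_def)
qed

lemma pending_le_level:
  assumes "on_track B s" "\<And>j. j \<in> dom s \<Longrightarrow> the (s j) \<ge> 0"
  shows "pending B s \<le> level B s"
proof -
  have "total s \<ge> 0" using assms(2) by (auto simp: total_def intro: sum_nonneg)
  then show ?thesis
    using gain_le[OF run_state_subset, of s "snd (run_state B s)"] level_on_track[OF assms(1)]
      level_nonneg[of s] by (auto simp: pending_def)
qed

end

section \<open>Cheapest completions in a matroid\<close>

context matroid
begin

definition completions :: "'e set \<Rightarrow> 'e set set" where
  "completions S = {T. S \<subseteq> T \<and> T \<subseteq> carrier \<and> (\<exists>X. basis indep X \<and> X \<subseteq> T)}"

text \<open>The residual price once \<open>S\<close> has been bought. For nonnegative weights and
  \<open>S = {}\<close> it is the weight of a cheapest basis.\<close>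

definition completion_cost :: "('e \<Rightarrow> real) \<Rightarrow> 'e set \<Rightarrow> real" where
  "completion_cost w S = (MIN T\<in>completions S. sum w (T - S))"

lemma indep_finite: "indep X \<Longrightarrow> finite X"
  using indep_subset_carrier carrier_finite finite_subset by blast

lemma indep_extend:
  assumes "indep A" "indep Y" "card A \<le> card Y"
  shows "\<exists>Z. A \<subseteq> Z \<and> Z \<subseteq> A \<union> Y \<and> indep Z \<and> card Z = card Y"
  using assms
proof (induction "card Y - card A" arbitrary: A)
  case 0
  then show ?case by auto
next
  case (Suc d)
  then obtain y where y: "y \<in> Y - A" "indep (insert y A)"
    using augment[of A Y] by force
  have c: "card (insert y A) = Suc (card A)"
    using y indep_finite[OF Suc.prems(1)] by auto
  then have "d = card Y - card (insert y A)" "card (insert y A) \<le> card Y"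
    using Suc.hyps(2) by linarith+
  from Suc.hyps(1)[OF this(1) y(2) Suc.prems(2) this(2)]
  obtain Z where "insert y A \<subseteq> Z" "Z \<subseteq> insert y A \<union> Y" "indep Z" "card Z = card Y"
    by blast
  then show ?case using y by blast
qed

lemma card_le_basis:
  assumes "basis indep X" "indep Y"
  shows "card Y \<le> card X"
proof (rule ccontr)
  assume "\<not> card Y \<le> card X"
  then obtain y where "y \<in> Y - X" "indep (insert y X)"
    using augment[of X Y] assms by (auto simp: basis_def)
  then show False using assms(1) by (auto simp: basis_def)
qed

lemma basis_of_card:
  assumes "basis indep X" "indep Y" "card Y = card X"
  shows "basis indep Y"
  unfolding basis_def
proof (intro conjI allI impI)
  fix Z assume "indep Z" "Y \<subseteq> Z"
  then show "Z = Y"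
    using card_le_basis[OF assms(1)] indep_finite assms(3) by (metis card_seteq)
qed fact

lemma basis_exists: "\<exists>X. basis indep X"
proof -
  have "finite {X. indep X}"
    using indep_subset_carrier carrier_finite
    by (intro finite_subset[of "{X. indep X}" "Pow carrier"]) auto
  then obtain X where "X \<in> {X. indep X}" "\<forall>Y\<in>{X. indep X}. X \<le> Y \<longrightarrow> X = Y"
    using finite_has_maximal[of "{X. indep X}"] indep_empty by auto
  then show ?thesis by (auto simp: basis_def)
qed

lemma finite_completions: "finite (completions S)"
  using carrier_finite by (intro finite_subset[of "completions S" "Pow carrier"]) (auto simp: completions_def)

lemma carrier_completion: "S \<subseteq> carrier \<Longrightarrow> carrier \<in> completions S"
  using basis_exists indep_subset_carrier by (auto simp: completions_def basis_def)

lemma completion_cost_le: "T \<in> completions S \<Longrightarrow> completion_cost w S \<le> sum w (T - S)"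
  unfolding completion_cost_def using finite_completions by (intro Min_le) auto

lemma completion_cost_attained:
  assumes "S \<subseteq> carrier"
  obtains T where "T \<in> completions S" "completion_cost w S = sum w (T - S)"
proof -
  have "completion_cost w S \<in> (\<lambda>T. sum w (T - S)) ` completions S"
    unfolding completion_cost_def using finite_completions carrier_completion[OF assms]
    by (intro Min_in) auto
  then show ?thesis using that by auto
qed

lemma completion_cost_insert:
  assumes "S \<subseteq> carrier" "i \<in> carrier - S"
  shows "completion_cost w S \<le> w i + completion_cost w (insert i S)"
proof -
  obtain T where T: "T \<in> completions (insert i S)"
    "completion_cost w (insert i S) = sum w (T - insert i S)"
    using completion_cost_attained[of "insert i S" w] assms by auto
  have "finite T" using T carrier_finite finite_subset by (auto simp: completions_def)
  have "T - S = insert i (T - insert i S)" using T assms by (auto simp: completions_def)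
  then have "sum w (T - S) = sum w (insert i (T - insert i S))" by (rule arg_cong)
  then have "sum w (T - S) = w i + sum w (T - insert i S)" using \<open>finite T\<close> by simp
  moreover have "T \<in> completions S" using T by (auto simp: completions_def)
  ultimately show ?thesis using completion_cost_le[of T S w] T by simp
qed

text \<open>Exchange argument: a cheapest completion that lacks \<open>i\<close> can trade some
  \<open>k\<close> for \<open>i\<close> at no extra cost.\<close>

lemma completion_cost_greedy:
  assumes "indep (insert i S)" "i \<notin> S"
    and min: "\<And>k. k \<notin> S \<Longrightarrow> indep (insert k S) \<Longrightarrow> w i \<le> w k"
  shows "w i + completion_cost w (insert i S) \<le> completion_cost w S"
proof -
  have S: "indep S" "insert i S \<subseteq> carrier"
    using assms(1) indep_subset indep_subset_carrier by blast+
  obtain T where T: "T \<in> completions S" "completion_cost w S = sum w (T - S)"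
    using completion_cost_attained[of S w] S by auto
  then obtain X where X: "basis indep X" "X \<subseteq> T" by (auto simp: completions_def)
  have finT: "finite T" using T carrier_finite finite_subset by (auto simp: completions_def)
  show ?thesis
  proof (cases "i \<in> T")
    case True
    then have "T - S = insert i (T - insert i S)" using assms by auto
    then have "sum w (T - S) = sum w (insert i (T - insert i S))" by (rule arg_cong)
    then have "sum w (T - S) = w i + sum w (T - insert i S)" using finT by simp
    moreover have "T \<in> completions (insert i S)" using T True by (auto simp: completions_def)
    ultimately show ?thesis using completion_cost_le[of T "insert i S" w] T by simp
  next
    case False
    have "indep X" using X by (simp add: basis_def)
    \<comment> \<open>\<open>Y\<close> is a basis inside \<open>T\<close> extending
      \<open>S\<close>, and \<open>Z\<close> a basis extending \<open>insert i S\<close> within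
      \<open>insert i Y\<close>. The sizes agree and only \<open>Z\<close> contains
      \<open>i\<close>, so some \<open>k\<close> of \<open>Y\<close> is missing from
      \<open>Z\<close>; trading it for \<open>i\<close> in \<open>T\<close> keeps \<open>Z\<close>
      inside.\<close>
    obtain Y where Y: "S \<subseteq> Y" "Y \<subseteq> S \<union> X" "indep Y" "card Y = card X"
      using indep_extend[OF S(1) \<open>indep X\<close> card_le_basis[OF X(1) S(1)]] by blast
    obtain Z where Z: "insert i S \<subseteq> Z" "Z \<subseteq> insert i S \<union> Y" "indep Z" "card Z = card Y"
      using indep_extend[OF assms(1) Y(3)] card_le_basis[OF X(1) assms(1)] Y(4) by auto
    have iY: "i \<notin> Y" using False Y X T assms(2) by auto
    have "\<not> Y \<subseteq> Z"
    proof
      assume "Y \<subseteq> Z"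
      then have "Y = Z" using Z(4) indep_finite[OF Z(3)] by (simp add: card_subset_eq)
      then show False using iY Z(1) by auto
    qed
    then obtain k where k: "k \<in> Y" "k \<notin> Z" by auto
    then have kS: "k \<notin> S" "k \<in> T" using Z Y X T by (auto simp: completions_def)
    have "indep (insert k S)" using indep_subset[OF Y(3)] k Y(1) by auto
    then have le: "w i \<le> w k" using min kS by auto
    let ?T = "insert i (T - {k})"
    have "S \<subseteq> T" using T by (simp add: completions_def)
    then have "Y \<subseteq> T" using Y(2) X(2) by blast
    then have "Z \<subseteq> ?T" using Z(2) k \<open>S \<subseteq> T\<close> by blast
    then have "?T \<in> completions (insert i S)"
      using basis_of_card[OF X(1) Z(3)] Z(1,4) Y(4) T S kS
      unfolding completions_def by (auto intro!: exI[of _ Z])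
    then have "completion_cost w (insert i S) \<le> sum w (?T - insert i S)"
      by (rule completion_cost_le)
    also have "?T - insert i S = T - S - {k}" using False by auto
    also have "sum w \<dots> = sum w (T - S) - w k" using finT kS by (simp add: sum_diff1)
    finally show ?thesis using le T by simp
  qed
qed

lemma not_spanning_augment:
  assumes "indep S" "\<not> (\<exists>X. basis indep X \<and> X \<subseteq> S)" "basis indep X"
  shows "\<exists>k\<in>X - S. indep (insert k S)"
proof -
  have "card S \<noteq> card X" using basis_of_card[OF assms(3,1)] assms(2) by auto
  then have "card S < card X" using card_le_basis[OF assms(3,1)] by auto
  then show ?thesis using augment[OF assms(1)] assms(3) by (simp add: basis_def)
qed

text \<open>A completion contains a basis, and some element of it extends \<open>S\<close>
  independently; its weight alone is at least \<open>m\<close>, and the other weights are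
  nonnegative.\<close>

lemma le_completion_cost:
  assumes "indep S" "\<not> (\<exists>X. basis indep X \<and> X \<subseteq> S)" "\<And>k. k \<in> carrier \<Longrightarrow> w k \<ge> 0"
    and "\<And>k. k \<notin> S \<Longrightarrow> indep (insert k S) \<Longrightarrow> m \<le> w k"
  shows "m \<le> completion_cost w S"
proof -
  obtain T where T: "T \<in> completions S" "completion_cost w S = sum w (T - S)"
    using completion_cost_attained[of S w] indep_subset_carrier[OF assms(1)] by auto
  then obtain X where X: "basis indep X" "X \<subseteq> T" by (auto simp: completions_def)
  obtain k where k: "k \<in> X - S" "indep (insert k S)"
    using not_spanning_augment[OF assms(1,2) X(1)] by auto
  have "w k \<le> sum w (T - S)"
    using T k X finite_subset[OF _ carrier_finite, of T] assms(3)
    by (intro member_le_sum) (auto simp: completions_def)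
  then show ?thesis using assms(4)[of k] k T by auto
qed

lemma completion_cost_nonneg:
  assumes "S \<subseteq> carrier" "\<And>k. k \<in> carrier \<Longrightarrow> w k \<ge> 0"
  shows "completion_cost w S \<ge> 0"
proof -
  obtain T where "T \<in> completions S" "completion_cost w S = sum w (T - S)"
    using completion_cost_attained[of S w] assms by auto
  then show ?thesis using assms(2) by (auto simp: completions_def intro!: sum_nonneg)
qed

lemma completion_cost_mono_scale:
  assumes "S \<subseteq> carrier" "\<And>k. k \<in> carrier \<Longrightarrow> w k \<le> a * w' k"
  shows "completion_cost w S \<le> a * completion_cost w' S"
proof -
  obtain T where T: "T \<in> completions S" "completion_cost w' S = sum w' (T - S)"
    using completion_cost_attained[of S w'] assms by auto
  have "completion_cost w S \<le> sum w (T - S)" using T(1) by (rule completion_cost_le)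
  also have "\<dots> \<le> (\<Sum>k\<in>T - S. a * w' k)"
    using T assms(2) by (intro sum_mono) (auto simp: completions_def)
  finally show ?thesis using T by (simp add: sum_distrib_left)
qed

end

section \<open>Conditional expectations given a configuration\<close>

lemma expectation_bind_finite:
  fixes f :: "'b \<Rightarrow> real"
  assumes "finite (set_pmf p)" "\<And>x. x \<in> set_pmf p \<Longrightarrow> finite (set_pmf (q x))"
  shows "measure_pmf.expectation (bind_pmf p q) f =
    measure_pmf.expectation p (\<lambda>x. measure_pmf.expectation (q x) f)"
  using assms by (subst pmf_expectation_bind[of "set_pmf p"])
    (auto simp: integral_measure_pmf[of "set_pmf p"])

lemma finite_set_Pi_pmf:
  assumes "finite A" "\<And>x. x \<in> A \<Longrightarrow> finite (set_pmf (p x))"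
  shows "finite (set_pmf (Pi_pmf A d p))"
  using assms by (subst set_Pi_pmf) auto

text \<open>Overwriting one coordinate of a product distribution by an independent fresh draw does
  not change the distribution; splitting off coordinate \<open>a\<close> makes both sides
  equal.\<close>

lemma expectation_Pi_pmf_resample:
  fixes f :: "('a \<Rightarrow> 'b) \<Rightarrow> real"
  assumes "finite A" "a \<in> A" "\<And>x. x \<in> A \<Longrightarrow> finite (set_pmf (p x))"
  shows "measure_pmf.expectation (Pi_pmf A d p) f =
    measure_pmf.expectation (p a) (\<lambda>v. measure_pmf.expectation (Pi_pmf A d p) (\<lambda>z. f (z(a := v))))"
proof -
  let ?Q = "Pi_pmf (A - {a}) d p"
  have fin: "finite (set_pmf ?Q)" "finite (set_pmf (p a))"
    using assms by (auto intro: finite_set_Pi_pmf)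
  have split: "Pi_pmf A d p = bind_pmf (p a) (\<lambda>y. map_pmf (\<lambda>g. g(a := y)) ?Q)"
    using Pi_pmf_insert'[of "A - {a}" a d p] assms by (simp add: insert_absorb map_pmf_def)
  have eq: "measure_pmf.expectation (Pi_pmf A d p) g =
      measure_pmf.expectation (p a) (\<lambda>y. measure_pmf.expectation ?Q (\<lambda>z. g (z(a := y))))"
    for g :: "('a \<Rightarrow> 'b) \<Rightarrow> real"
    unfolding split using fin by (subst expectation_bind_finite) auto
  show ?thesis
    by (simp add: eq)
qed

type_synonym box_states = "nat \<Rightarrow> (nat \<rightharpoonup> real)"

locale apb = matroid "{..<n}" indep for n :: nat and indep :: "nat set \<Rightarrow> bool" +
  fixes B :: "nat \<Rightarrow> additive_box"
  assumes valid_boxes: "i < n \<Longrightarrow> valid_box (B i)"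
begin

abbreviation "I \<equiv> matroid_apb n B indep"
abbreviation "box_parts i \<equiv> {..<num_components (B i)}"

lemma component_box: "i < n \<Longrightarrow> component_box (B i)"
  using valid_boxes by (simp add: component_box_def)

text \<open>All values are drawn in advance, so that expectations over future probes become sums
  over one finite product. The 0 is the default off the index set.\<close>

definition draws :: "(nat \<times> nat \<Rightarrow> real) pmf" where
  "draws = Pi_pmf (SIGMA i:{..<n}. box_parts i) 0 (\<lambda>(i, j). component_dist (B i) j)"

definition complete :: "box_states \<Rightarrow> (nat \<times> nat \<Rightarrow> real) \<Rightarrow> box_states" where
  "complete \<sigma> z i = (\<lambda>j. if j < num_components (B i)
     then Some (case \<sigma> i j of Some v \<Rightarrow> v | None \<Rightarrow> z (i, j)) else None)"

text \<open>By independence this is the conditional expectation given the revealed values: only the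
  unrevealed coordinates of \<open>z\<close> enter \<open>complete\<close>.\<close>

definition cond_exp :: "(box_states \<Rightarrow> real) \<Rightarrow> box_states \<Rightarrow> real" where
  "cond_exp F \<sigma> = measure_pmf.expectation draws (\<lambda>z. F (complete \<sigma> z))"

definition possible :: "box_states \<Rightarrow> bool" where
  "possible \<sigma> \<longleftrightarrow> (\<forall>i<n. \<sigma> i \<in> mdp_states (additive_mdp (B i)))"

lemma finite_draws: "finite (set_pmf draws)"
  unfolding draws_def using component_box component_box.component_support(1)
  by (intro finite_set_Pi_pmf) auto

lemma dom_complete: "dom (complete \<sigma> z i) = box_parts i"
  by (auto simp: complete_def split: if_splits)

lemma possible_dom: "possible \<sigma> \<Longrightarrow> i < n \<Longrightarrow> dom (\<sigma> i) \<subseteq> box_parts i"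
  by (simp add: possible_def additive_mdp_def)

lemma possible_nonneg:
  assumes "possible \<sigma>" "i < n" "j \<in> dom (\<sigma> i)"
  shows "the (\<sigma> i j) \<ge> 0"
proof -
  have "j < num_components (B i)" "the (\<sigma> i j) \<in> set_pmf (component_dist (B i) j)"
    using assms by (auto simp: possible_def additive_mdp_def)
  then show ?thesis
    using component_box.component_support(2)[OF component_box] assms(2) by auto
qed

lemma le_complete: "possible \<sigma> \<Longrightarrow> i < n \<Longrightarrow> \<sigma> i \<subseteq>\<^sub>m complete \<sigma> z i"
  using possible_dom[of \<sigma> i] by (auto simp: map_le_def complete_def)

lemma complete_full:
  assumes "dom (\<sigma> i) = box_parts i"
  shows "complete \<sigma> z i = \<sigma> i"
proof (rule ext)
  fix j
  have "j < num_components (B i) \<longleftrightarrow> \<sigma> i j \<noteq> None"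
    using assms by (metis domIff lessThan_iff)
  then show "complete \<sigma> z i j = \<sigma> i j"
    by (auto simp: complete_def)
qed

lemma possible_complete:
  assumes "possible \<sigma>" "z \<in> set_pmf draws"
  shows "possible (complete \<sigma> z)"
proof -
  have "finite (SIGMA i:{..<n}. box_parts i)" by simp
  then have "z (i, j) \<in> set_pmf (component_dist (B i) j)" if "i < n" "j < num_components (B i)" for i j
    using assms(2) that unfolding draws_def
    by (subst (asm) set_Pi_pmf) (auto simp: PiE_dflt_def)
  moreover have "v \<in> set_pmf (component_dist (B i) j)" if "i < n" "\<sigma> i j = Some v" for i j v
    using assms(1) that by (fastforce simp: possible_def additive_mdp_def dom_def)
  ultimately have "the (complete \<sigma> z i j) \<in> set_pmf (component_dist (B i) j)"
    if "i < n" "j < num_components (B i)" for i j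
    using that by (cases "\<sigma> i j") (auto simp: complete_def)
  then show ?thesis
    by (simp add: possible_def additive_mdp_def dom_complete)
qed

lemma possible_update:
  assumes "possible \<sigma>" "i < n" "j < num_components (B i)" "v \<in> set_pmf (component_dist (B i) j)"
  shows "possible (\<sigma>(i := (\<sigma> i)(j \<mapsto> v)))"
  using assms by (auto simp: possible_def additive_mdp_def)

lemma cond_exp_mono:
  assumes "\<And>z. z \<in> set_pmf draws \<Longrightarrow> F (complete \<sigma> z) \<le> G (complete \<sigma> z)"
  shows "cond_exp F \<sigma> \<le> cond_exp G \<sigma>"
  unfolding cond_exp_def using assms by (intro expectation_mono_finite finite_draws)

lemma cond_exp_affine: "cond_exp (\<lambda>\<tau>. a * F \<tau> + b) \<sigma> = a * cond_exp F \<sigma> + b"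
  unfolding cond_exp_def
  by (subst Bochner_Integration.integral_add) (auto intro: integrable_measure_pmf_finite finite_draws)

lemma le_cond_exp:
  assumes "\<And>z. z \<in> set_pmf draws \<Longrightarrow> b \<le> F (complete \<sigma> z)"
  shows "b \<le> cond_exp F \<sigma>"
  using cond_exp_mono[of "\<lambda>_. b" \<sigma> F] assms by (simp add: cond_exp_def)

text \<open>Tower property: the probed coordinate may be drawn first, since the draw for a revealed
  component is ignored.\<close>

lemma cond_exp_probe:
  assumes "i < n" "j < num_components (B i)" "\<sigma> i j = None"
  shows "cond_exp F \<sigma> =
    measure_pmf.expectation (component_dist (B i) j) (\<lambda>v. cond_exp F (\<sigma>(i := (\<sigma> i)(j \<mapsto> v))))"
proof -
  have "complete \<sigma> (z((i, j) := v)) = complete (\<sigma>(i := (\<sigma> i)(j \<mapsto> v))) z" for v z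
    using assms by (intro ext) (auto simp: complete_def split: option.splits)
  moreover have "finite (set_pmf ((\<lambda>(i, j). component_dist (B i) j) x))"
    if "x \<in> (SIGMA i:{..<n}. box_parts i)" for x
    using that component_box component_box.component_support(1) by auto
  ultimately show ?thesis
    unfolding cond_exp_def draws_def using assms
    by (subst expectation_Pi_pmf_resample[where a = "(i, j)"]) auto
qed

section \<open>The lower bound\<close>

text \<open>\<open>credit\<close> is the part of \<open>paid_value\<close> that the probing costs incurred so far account for.\<close>

definition paid_value :: "box_states \<Rightarrow> nat \<Rightarrow> real" where
  "paid_value \<tau> i = max (total (\<tau> i)) (reserve (B i) (box_parts i))"

definition credit :: "nat \<Rightarrow> (nat \<rightharpoonup> real) \<Rightarrow> real" where
  "credit i s = gain (B i) (box_parts i - dom s) (reserve (B i) (box_parts i) - total s)"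

text \<open>Expected price of completing \<open>S\<close>, less what probing has already paid for on
  the unselected boxes. Under any policy, the cost so far plus this potential does not fall on
  average.\<close>

fun lower_potential :: "box_states \<times> nat set \<Rightarrow> real" where
  "lower_potential (\<sigma>, S) = cond_exp (\<lambda>\<tau>. completion_cost (paid_value \<tau>) S) \<sigma> -
     (\<Sum>i\<in>{..<n} - S. credit i (\<sigma> i))"

text \<open>Bounds the number of further moves, which makes the truncation in
  \<open>cost_upto\<close> harmless.\<close>

fun remaining :: "box_states \<times> nat set \<Rightarrow> nat" where
  "remaining (\<sigma>, S) = (\<Sum>i<n. card (box_parts i - dom (\<sigma> i))) + card ({..<n} - S)"

fun valid_config :: "box_states \<times> nat set \<Rightarrow> bool" where
  "valid_config (\<sigma>, S) \<longleftrightarrow> possible \<sigma> \<and> S \<subseteq> {..<n}"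

section \<open>Moves and reachable configurations\<close>

lemma available_cases:
  assumes "m \<in> available I (\<sigma>, S)"
  obtains i j where "m = Advance i j" "i < n" "j < num_components (B i)" "\<sigma> i j = None"
  | i where "m = Select i" "i < n" "i \<notin> S" "dom (\<sigma> i) = box_parts i"
  using assms by (auto simp: available_def matroid_apb_def additive_mdp_def)

lemma move_step_Advance:
  "move_step I (\<sigma>, S) (Advance i j) =
     map_pmf (\<lambda>v. (\<sigma>(i := (\<sigma> i)(j \<mapsto> v)), S)) (component_dist (B i) j)"
  by (simp add: matroid_apb_def additive_mdp_def pmf.map_comp o_def)

lemma move_cost_Advance: "move_cost I (\<sigma>, S) (Advance i j) = ennreal (probing_cost (B i) j)"
  by (simp add: matroid_apb_def additive_mdp_def)

lemma move_cost_Select: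
  "dom (\<sigma> i) = box_parts i \<Longrightarrow> move_cost I (\<sigma>, S) (Select i) = ennreal (total (\<sigma> i))"
  by (simp add: matroid_apb_def additive_mdp_def total_def)

lemma finished_iff:
  "finished I h \<longleftrightarrow> snd (current I h) \<subseteq> {..<n} \<and> (\<exists>X. basis indep X \<and> X \<subseteq> snd (current I h))"
  by (auto simp: finished_def matroid_apb_def)

lemma current_Nil: "current I [] = (\<lambda>_. Map.empty, {})"
  by (simp add: current_def matroid_apb_def additive_mdp_def)

lemma current_Cons: "current I ((m, g) # h) = g"
  by (simp add: current_def)

lemma valid_config_step:
  assumes "valid_config (\<sigma>, S)" "m \<in> available I (\<sigma>, S)" "g \<in> set_pmf (move_step I (\<sigma>, S) m)"
  shows "valid_config g" "remaining g < remaining (\<sigma>, S)"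
proof -
  show "valid_config g"
    using assms(2)
  proof (cases rule: available_cases)
    case (1 i j)
    then have "\<exists>v\<in>set_pmf (component_dist (B i) j). g = (\<sigma>(i := (\<sigma> i)(j \<mapsto> v)), S)"
      using assms(3) unfolding 1(1) move_step_Advance by auto
    then show ?thesis using assms(1) possible_update 1 by auto
  qed (use assms in auto)
  show "remaining g < remaining (\<sigma>, S)"
    using assms(2)
  proof (cases rule: available_cases)
    case (1 i j)
    then obtain v where g: "g = (\<sigma>(i := (\<sigma> i)(j \<mapsto> v)), S)"
      using assms(3) unfolding 1(1) move_step_Advance by auto
    have sub: "box_parts i - insert j (dom (\<sigma> i)) \<subset> box_parts i - dom (\<sigma> i)"
      using 1 by auto
    have "(\<Sum>k<n. card (box_parts k - dom ((\<sigma>(i := (\<sigma> i)(j \<mapsto> v))) k))) <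
        (\<Sum>k<n. card (box_parts k - dom (\<sigma> k)))"
    proof (rule sum_strict_mono_ex1)
      show "\<forall>k\<in>{..<n}. card (box_parts k - dom ((\<sigma>(i := (\<sigma> i)(j \<mapsto> v))) k))
          \<le> card (box_parts k - dom (\<sigma> k))"
        by (intro ballI card_mono) auto
      have "card (box_parts i - dom ((\<sigma>(i := (\<sigma> i)(j \<mapsto> v))) i)) < card (box_parts i - dom (\<sigma> i))"
        using sub by (auto intro: psubset_card_mono)
      then show "\<exists>k\<in>{..<n}. card (box_parts k - dom ((\<sigma>(i := (\<sigma> i)(j \<mapsto> v))) k))
          < card (box_parts k - dom (\<sigma> k))"
        using 1 by blast
    qed simp
    then show ?thesis by (simp add: g)
  next
    case (2 i)
    then have "g = (\<sigma>, insert i S)" using assms(3) by simp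
    moreover have "card ({..<n} - insert i S) < card ({..<n} - S)"
      using 2 by (intro psubset_card_mono) auto
    ultimately show ?thesis by simp
  qed
qed

lemma valid_config_history: "h \<in> histories I \<Longrightarrow> valid_config (current I h)"
proof (induction rule: histories.induct)
  case Nil
  show ?case by (simp add: current_Nil possible_def additive_mdp_def)
next
  case (Cons h m g)
  then show ?case
    using valid_config_step by (cases "current I h") (auto simp: current_Cons)
qed

text \<open>\<open>lower_potential\<close> can be negative, where \<open>ennreal\<close> yields 0;
  hence \<open>c\<close> is allowed any sign.\<close>

lemma ennreal_le_add:
  assumes "a \<le> b + c" "0 \<le> b"
  shows "ennreal a \<le> ennreal b + ennreal c"
proof (cases "0 \<le> c")
  case True
  then show ?thesis using assms by (simp flip: ennreal_plus)
next
  case False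
  then show ?thesis using assms by (simp add: ennreal_neg ennreal_leI)
qed

lemma ennreal_expectation_le:
  fixes p :: "'c pmf" and f :: "'c \<Rightarrow> real"
  assumes "finite (set_pmf p)"
  shows "ennreal (measure_pmf.expectation p f) \<le> (\<integral>\<^sup>+x. ennreal (f x) \<partial>measure_pmf p)"
proof -
  have "measure_pmf.expectation p f \<le> measure_pmf.expectation p (\<lambda>x. max 0 (f x))"
    using assms by (intro expectation_mono_finite) auto
  then have "ennreal (measure_pmf.expectation p f) \<le> ennreal (measure_pmf.expectation p (\<lambda>x. max 0 (f x)))"
    by (rule ennreal_leI)
  also have "\<dots> = (\<integral>\<^sup>+x. ennreal (max 0 (f x)) \<partial>measure_pmf p)"
    using assms by (intro nn_integral_eq_integral[symmetric] integrable_measure_pmf_finite) auto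
  finally show ?thesis by (simp add: ennreal_max_0)
qed

text \<open>Probing \<open>j\<close> is one of the choices in the maximum behind
  \<open>advantage\<close>, which is at most the gain. An arbitrary probe thus yields an inequality
  where \<open>pending_step\<close> has equality.\<close>

lemma credit_probe:
  assumes "i < n" "dom s \<subseteq> box_parts i" "j < num_components (B i)" "s j = None"
  shows "measure_pmf.expectation (component_dist (B i) j) (\<lambda>v. credit i (s(j \<mapsto> v)))
    \<le> credit i s + probing_cost (B i) j"
proof -
  define R x where "R = box_parts i - dom s" and "x = reserve (B i) (box_parts i) - total s"
  have fin: "finite (dom s)" using assms(2) finite_subset by blast
  interpret component_box "B i" using assms component_box by blast
  have "credit i (s(j \<mapsto> v)) = gain (B i) (R - {j}) (x - v)" for v
    using assms total_update[OF fin, of j v]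
    by (auto simp: credit_def R_def x_def Diff_insert2[symmetric] domIff algebra_simps intro!: arg_cong2[of _ _ _ _ "gain (B i)"])
  moreover have "probe_value (B i) R x j \<le> advantage (B i) R x"
    using assms by (intro probe_value_le_advantage) (auto simp: R_def)
  ultimately show ?thesis
    by (simp add: probe_value_def credit_def gain_def R_def[symmetric] x_def[symmetric])
qed

text \<open>A probe preserves the conditional expectation on average and raises the credits by at
  most its cost. A selection cashes in the credit of the box: the price paid falls short of
  \<open>paid_value\<close> by exactly that amount.\<close>

lemma lower_potential_move:
  assumes "valid_config (\<sigma>, S)" "m \<in> available I (\<sigma>, S)"
  shows "ennreal (lower_potential (\<sigma>, S)) \<le> move_cost I (\<sigma>, S) m +
    (\<integral>\<^sup>+g. ennreal (lower_potential g) \<partial>measure_pmf (move_step I (\<sigma>, S) m))"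
  using assms(2)
proof (cases rule: available_cases)
  case (1 i j)
  interpret component_box "B i" using 1 component_box by blast
  let ?p = "component_dist (B i) j"
  let ?\<sigma> = "\<lambda>v. \<sigma>(i := (\<sigma> i)(j \<mapsto> v))"
  have jp: "j \<in> box_parts i" using 1 by simp
  note int = integrable_component[OF jp]
  define F where "F = (\<lambda>\<tau>. completion_cost (paid_value \<tau>) S)"
  have c0: "probing_cost (B i) j \<ge> 0" by (rule probing_cost_nonneg[OF jp])
  have credits: "measure_pmf.expectation ?p (\<lambda>v. \<Sum>k\<in>{..<n} - S. credit k (?\<sigma> v k))
      \<le> (\<Sum>k\<in>{..<n} - S. credit k (\<sigma> k)) + probing_cost (B i) j"
  proof (cases "i \<in> S")
    case True
    then have "(\<Sum>k\<in>{..<n} - S. credit k (?\<sigma> v k)) = (\<Sum>k\<in>{..<n} - S. credit k (\<sigma> k))" for v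
      by (intro sum.cong) auto
    then show ?thesis using c0 by simp
  next
    case False
    then have split: "{..<n} - S = insert i ({..<n} - S - {i})" using 1 by auto
    have "(\<Sum>k\<in>{..<n} - S. credit k (?\<sigma> v k)) =
        credit i ((\<sigma> i)(j \<mapsto> v)) + (\<Sum>k\<in>{..<n} - S - {i}. credit k (\<sigma> k))" for v
      by (subst split, subst sum.insert) (auto intro!: sum.cong)
    moreover have "(\<Sum>k\<in>{..<n} - S. credit k (\<sigma> k)) =
        credit i (\<sigma> i) + (\<Sum>k\<in>{..<n} - S - {i}. credit k (\<sigma> k))"
      by (subst split, subst sum.insert) auto
    ultimately show ?thesis
      using credit_probe[of i "\<sigma> i" j] 1 possible_dom[of \<sigma> i] assms(1) int by simp
  qed
  have "lower_potential (\<sigma>, S) \<le>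
      probing_cost (B i) j + measure_pmf.expectation ?p (\<lambda>v. lower_potential (?\<sigma> v, S))"
    using credits cond_exp_probe[of i j \<sigma> F] 1 int by (simp add: F_def)
  then have "ennreal (lower_potential (\<sigma>, S)) \<le>
      ennreal (probing_cost (B i) j) + ennreal (measure_pmf.expectation ?p (\<lambda>v. lower_potential (?\<sigma> v, S)))"
    using c0 by (rule ennreal_le_add)
  also have "\<dots> \<le> ennreal (probing_cost (B i) j) + (\<integral>\<^sup>+v. ennreal (lower_potential (?\<sigma> v, S)) \<partial>measure_pmf ?p)"
    by (intro add_left_mono ennreal_expectation_le component_support(1)[OF jp])
  finally show ?thesis
    unfolding 1(1) move_cost_Advance move_step_Advance by simp
next
  case (2 i)
  have S: "S \<subseteq> {..<n}" "possible \<sigma>" using assms by auto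
  have full: "complete \<sigma> z i = \<sigma> i" for z using 2 by (intro complete_full)
  have split: "{..<n} - S = insert i ({..<n} - insert i S)" using 2 by auto
  have t: "total (\<sigma> i) \<ge> 0"
    using possible_nonneg[OF S(2) 2(2)] by (auto simp: total_def intro: sum_nonneg)
  have "cond_exp (\<lambda>\<tau>. completion_cost (paid_value \<tau>) S) \<sigma> \<le>
      cond_exp (\<lambda>\<tau>. 1 * completion_cost (paid_value \<tau>) (insert i S) + paid_value \<sigma> i) \<sigma>"
  proof (rule cond_exp_mono)
    fix z
    have "paid_value (complete \<sigma> z) i = paid_value \<sigma> i" by (simp add: paid_value_def full)
    then show "completion_cost (paid_value (complete \<sigma> z)) S \<le>
        1 * completion_cost (paid_value (complete \<sigma> z)) (insert i S) + paid_value \<sigma> i"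
      using completion_cost_insert[OF S(1), of i "paid_value (complete \<sigma> z)"] 2 by simp
  qed
  moreover have "paid_value \<sigma> i - credit i (\<sigma> i) = total (\<sigma> i)"
    using 2 by (simp add: paid_value_def credit_def gain_def)
  moreover have "(\<Sum>k\<in>{..<n} - S. credit k (\<sigma> k)) =
      credit i (\<sigma> i) + (\<Sum>k\<in>{..<n} - insert i S. credit k (\<sigma> k))"
    by (subst split, subst sum.insert) auto
  ultimately have "lower_potential (\<sigma>, S) \<le> total (\<sigma> i) + lower_potential (\<sigma>, insert i S)"
    unfolding cond_exp_affine by simp
  then have "ennreal (lower_potential (\<sigma>, S)) \<le> ennreal (total (\<sigma> i)) + ennreal (lower_potential (\<sigma>, insert i S))"
    using t by (rule ennreal_le_add)
  then show ?thesis
    unfolding 2(1) move_cost_Select[of \<sigma> i, OF 2(4)] by simp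
qed

text \<open>A feasible set has completion cost at most 0 and credits are nonnegative, so the
  potential is at most 0 when a run ends; before that, \<open>lower_potential_move\<close> is
  averaged over the moves of the policy.\<close>

lemma lower_potential_le_cost:
  assumes "\<pi> \<in> policies I" "h \<in> histories I" "remaining (current I h) \<le> N"
  shows "ennreal (lower_potential (current I h)) \<le> cost_upto I \<pi> N h"
  using assms(2,3)
proof (induction N arbitrary: h)
  case (0 h)
  obtain \<sigma> S where c: "current I h = (\<sigma>, S)" by fastforce
  then have "S = {..<n}"
    using 0 valid_config_history[OF "0.prems"(1)] by auto
  then have "completion_cost w S \<le> 0" for w
    using completion_cost_le[OF carrier_completion, of S w] by simp
  then have "cond_exp (\<lambda>\<tau>. completion_cost (paid_value \<tau>) S) \<sigma> \<le> cond_exp (\<lambda>\<tau>. 0) \<sigma>"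
    by (intro cond_exp_mono)
  then show ?case using \<open>S = {..<n}\<close> by (simp add: c cond_exp_def ennreal_neg)
next
  case (Suc N h)
  obtain \<sigma> S where c: "current I h = (\<sigma>, S)" by fastforce
  have vc: "valid_config (\<sigma>, S)" using valid_config_history[OF Suc.prems(1)] c by simp
  show ?case
  proof (cases "finished I h")
    case True
    then have "S \<in> completions S" using c by (auto simp: finished_iff completions_def)
    then have "completion_cost w S \<le> 0" for w
      using completion_cost_le[of S S w] by simp
    then have "cond_exp (\<lambda>\<tau>. completion_cost (paid_value \<tau>) S) \<sigma> \<le> cond_exp (\<lambda>\<tau>. 0) \<sigma>"
      by (intro cond_exp_mono)
    moreover have "(\<Sum>i\<in>{..<n} - S. credit i (\<sigma> i)) \<ge> 0"
      by (intro sum_nonneg) (simp add: credit_def gain_nonneg)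
    ultimately show ?thesis by (simp add: c cond_exp_def ennreal_neg)
  next
    case False
    have "ennreal (lower_potential (\<sigma>, S)) \<le> move_cost I (\<sigma>, S) m +
        (\<integral>\<^sup>+g. cost_upto I \<pi> N ((m, g) # h) \<partial>measure_pmf (move_step I (\<sigma>, S) m))"
      if m: "m \<in> set_pmf (\<pi> h)" for m
    proof -
      have av: "m \<in> available I (\<sigma>, S)"
        using m assms(1) Suc.prems(1) False unfolding c[symmetric] policies_def by blast
      have "ennreal (lower_potential g) \<le> cost_upto I \<pi> N ((m, g) # h)"
        if g: "g \<in> set_pmf (move_step I (\<sigma>, S) m)" for g
      proof -
        have "(m, g) # h \<in> histories I"
          using Suc.prems(1) False av g c by (intro histories.Cons) auto
        moreover have "remaining g \<le> N"
          using valid_config_step(2)[OF vc av g] Suc.prems(2) c by simp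
        ultimately show ?thesis using Suc.IH[of "(m, g) # h"] by (simp add: current_Cons)
      qed
      then have "(\<integral>\<^sup>+g. ennreal (lower_potential g) \<partial>measure_pmf (move_step I (\<sigma>, S) m)) \<le>
          (\<integral>\<^sup>+g. cost_upto I \<pi> N ((m, g) # h) \<partial>measure_pmf (move_step I (\<sigma>, S) m))"
        by (intro nn_integral_mono_AE) (simp add: AE_measure_pmf_iff)
      then show ?thesis
        using lower_potential_move[OF vc av] add_left_mono order_trans by blast
    qed
    then have "(\<integral>\<^sup>+m. ennreal (lower_potential (\<sigma>, S)) \<partial>measure_pmf (\<pi> h)) \<le> cost_upto I \<pi> (Suc N) h"
      using False by (simp only: cost_upto.simps if_False c)
        (intro nn_integral_mono_AE, simp add: AE_measure_pmf_iff)
    then show ?thesis by (simp add: c measure_pmf.emeasure_space_1)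
  qed
qed

lemma lower_bound:
  "ennreal (cond_exp (\<lambda>\<tau>. completion_cost (paid_value \<tau>) {}) (\<lambda>_. Map.empty)) \<le> opt I"
  unfolding opt_def
proof (rule INF_greatest)
  fix \<pi> assume "\<pi> \<in> policies I"
  then have "ennreal (lower_potential (current I [])) \<le> cost_upto I \<pi> (remaining (current I [])) []"
    by (intro lower_potential_le_cost histories.Nil) auto
  also have "\<dots> \<le> expected_cost I \<pi>"
    unfolding expected_cost_def by (rule SUP_upper) simp
  \<comment> \<open>The initial credits vanish because the gain at the reservation value is
    0.\<close>
  also have "lower_potential (current I []) =
      cond_exp (\<lambda>\<tau>. completion_cost (paid_value \<tau>) {}) (\<lambda>_. Map.empty)"
    using component_box.gain_reserve[OF component_box]
    by (simp add: current_Nil credit_def total_def)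
  finally show "ennreal (cond_exp (\<lambda>\<tau>. completion_cost (paid_value \<tau>) {}) (\<lambda>_. Map.empty))
      \<le> expected_cost I \<pi>" .
qed

end

section \<open>The committing policy\<close>

context apb
begin

definition commitment :: "nat \<Rightarrow> (nat \<rightharpoonup> real) \<Rightarrow> nat pmf" where
  "commitment i s = return_pmf (committed_probe (B i) s)"

definition levels :: "box_states \<Rightarrow> nat \<Rightarrow> real" where
  "levels \<sigma> i = level (B i) (\<sigma> i)"

text \<open>The fallback set keeps the policy legal on histories that it does not produce itself,
  where \<open>S\<close> may be dependent and no box can be added independently.
  \<open>arg_min_on\<close> depends only on \<open>l\<close> and the candidates, so ties are broken
  consistently.\<close>

definition chosen :: "(nat \<Rightarrow> real) \<Rightarrow> nat set \<Rightarrow> nat" where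
  "chosen l S = arg_min_on l (if {i \<in> {..<n} - S. indep (insert i S)} = {} then {..<n} - S
     else {i \<in> {..<n} - S. indep (insert i S)})"

fun next_unit_move :: "box_states \<times> nat set \<Rightarrow> unit move" where
  "next_unit_move (\<sigma>, S) = (let i = chosen (levels \<sigma>) S in
     if dom (\<sigma> i) = box_parts i then Select i else Advance i ())"

text \<open>The trivial \<open>bind_pmf\<close> gives the policy the form that
  \<open>committing_policies\<close> demands.\<close>

definition greedy_policy :: "(nat \<rightharpoonup> real, nat) policy" where
  "greedy_policy h = bind_pmf (return_pmf (next_unit_move (current I h))) (follow commitment (current I h))"

definition spanning :: "nat set \<Rightarrow> bool" where
  "spanning S \<longleftrightarrow> (\<exists>X. basis indep X \<and> X \<subseteq> S)"

text \<open>A policy may abandon a box only when its pending gain is zero.  This is ensured by breaking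
  ties between levels consistently: as long as the gain of the chosen box is positive, its level
  does not change, so it remains chosen.\<close>

fun good :: "box_states \<times> nat set \<Rightarrow> bool" where
  "good (\<sigma>, S) \<longleftrightarrow> valid_config (\<sigma>, S) \<and> indep S \<and> (\<forall>i<n. on_track (B i) (\<sigma> i)) \<and>
     (\<forall>k\<in>{..<n} - S. pending (B k) (\<sigma> k) > 0 \<longrightarrow>
        k = chosen (levels \<sigma>) S \<and> indep (insert k S))"

text \<open>Counterpart of \<open>lower_potential\<close> with final levels as weights. Under the
  greedy policy, the cost so far plus this potential does not rise on average.\<close>

fun upper_potential :: "box_states \<times> nat set \<Rightarrow> real" where
  "upper_potential (\<sigma>, S) = cond_exp (\<lambda>\<tau>. completion_cost (levels \<tau>) S) \<sigma> -
     (\<Sum>i\<in>{..<n} - S. pending (B i) (\<sigma> i))"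

lemma good_pending:
  assumes "good (\<sigma>, S)" "k \<in> {..<n} - S" "pending (B k) (\<sigma> k) > 0"
  shows "k = chosen (levels \<sigma>) S" "indep (insert k S)"
  using assms unfolding good.simps by blast+

section \<open>Legality of the commitment and of the greedy policy\<close>

lemma commitment_in: "commitment \<in> commitments I"
proof -
  have "committed_probe (B i) s \<in> mdp_actions (mdp I i) s"
    if "i < n" "s \<in> mdp_states (mdp I i) - mdp_terminal (mdp I i)" for i s
    using component_box.committed_probe_unprobed[OF component_box[OF that(1)], of s] that(2)
    by (auto simp: matroid_apb_def additive_mdp_def)
  then show ?thesis by (auto simp: commitments_def commitment_def matroid_apb_def)
qed

lemma greedy_policy_eq:
  assumes "current I h = (\<sigma>, S)" "i = chosen (levels \<sigma>) S"
  shows "greedy_policy h = return_pmf (if dom (\<sigma> i) = box_parts i then Select i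
    else Advance i (committed_probe (B i) (\<sigma> i)))"
  using assms by (simp add: greedy_policy_def bind_return_pmf Let_def commitment_def)

lemma chosen_unselected:
  assumes "S \<subseteq> {..<n}" "\<not> spanning S"
  shows "chosen l S \<in> {..<n} - S"
proof -
  have "{..<n} - S \<noteq> {}"
  proof
    assume "{..<n} - S = {}"
    then have "S = {..<n}" using assms by auto
    then show False
      using assms(2) basis_exists indep_subset_carrier by (auto simp: spanning_def basis_def)
  qed
  then show ?thesis
    using arg_min_if_finite(1)[of "{..<n} - S" l]
      arg_min_if_finite(1)[of "{i \<in> {..<n} - S. indep (insert i S)}" l]
    by (auto simp: chosen_def split: if_splits)
qed

lemma chosen_minimal:
  assumes "indep S" "\<not> spanning S"
  shows "indep (insert (chosen l S) S)"
    and "k \<notin> S \<Longrightarrow> indep (insert k S) \<Longrightarrow> l (chosen l S) \<le> l k"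
proof -
  let ?C = "{i \<in> {..<n} - S. indep (insert i S)}"
  obtain X where X: "basis indep X" using basis_exists by blast
  then obtain y where "y \<in> X - S" "indep (insert y S)"
    using not_spanning_augment[OF assms(1)] assms(2) unfolding spanning_def by blast
  then have ne: "?C \<noteq> {}" using indep_subset_carrier by blast
  then have eq: "chosen l S = arg_min_on l ?C" by (simp only: chosen_def if_False)
  have "finite ?C" by simp
  note am = arg_min_if_finite[OF this ne, of l]
  show "indep (insert (chosen l S) S)" using am(1) unfolding eq by blast
  show "l (chosen l S) \<le> l k" if "k \<notin> S" "indep (insert k S)"
  proof -
    have "k \<in> ?C" using that indep_subset_carrier by blast
    then show ?thesis using am(2) unfolding eq by (meson not_less)
  qed
qed

lemma greedy_policy_available:
  assumes "h \<in> histories I" "\<not> finished I h"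
  shows "set_pmf (greedy_policy h) \<subseteq> available I (current I h)"
proof -
  obtain \<sigma> S where c: "current I h = (\<sigma>, S)" by fastforce
  have vc: "possible \<sigma>" "S \<subseteq> {..<n}" using valid_config_history[OF assms(1)] c by auto
  have ns: "\<not> spanning S" using assms(2) vc by (auto simp: finished_iff c spanning_def)
  define i where "i = chosen (levels \<sigma>) S"
  have i: "i < n" "i \<notin> S" using chosen_unselected[OF vc(2) ns] by (auto simp: i_def)
  have "committed_probe (B i) (\<sigma> i) \<in> box_parts i - dom (\<sigma> i)" if "dom (\<sigma> i) \<noteq> box_parts i"
    using component_box.committed_probe_unprobed[OF component_box[OF i(1)]] possible_dom[OF vc(1) i(1)] that
    by blast
  then show ?thesis
    using i unfolding greedy_policy_eq[OF c i_def] c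
    by (auto simp: available_def matroid_apb_def additive_mdp_def)
qed

lemma greedy_policy_committing: "greedy_policy \<in> committing_policies I commitment"
  unfolding committing_policies_def policies_def
  using greedy_policy_available greedy_policy_def by fastforce

section \<open>Amortized cost of the greedy policy\<close>

lemma level_le_levels_complete:
  assumes "good (\<sigma>, S)" "k < n"
  shows "level (B k) (\<sigma> k) \<le> levels (complete \<sigma> z) k"
  unfolding levels_def using assms le_complete[of \<sigma> k z]
  by (intro component_box.level_mono[OF component_box]) auto

lemma levels_nonneg: "k < n \<Longrightarrow> levels \<sigma> k \<ge> 0"
  unfolding levels_def by (rule component_box.level_nonneg[OF component_box])

text \<open>Over a spanning \<open>S\<close> no further box is independent, so \<open>good\<close>
  leaves no pending gain. Otherwise only the chosen box can have one; it is at most the level of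
  that box, and every completion buys a box whose final level is at least as large.\<close>

lemma upper_potential_nonneg:
  assumes "good (\<sigma>, S)"
  shows "upper_potential (\<sigma>, S) \<ge> 0"
proof (cases "spanning S")
  case True
  have S: "indep S" "S \<subseteq> {..<n}" using assms by auto
  obtain X where X: "basis indep X" "X \<subseteq> S" using True by (auto simp: spanning_def)
  have "\<not> indep (insert k S)" if "k \<notin> S" for k
  proof
    assume "indep (insert k S)"
    then have "card (insert k S) \<le> card X" using card_le_basis X by blast
    also have "\<dots> \<le> card S" using X indep_finite[OF S(1)] by (intro card_mono)
    finally show False using that indep_finite[OF S(1)] by simp
  qed
  then have "pending (B k) (\<sigma> k) = 0" if "k \<in> {..<n} - S" for k
    using assms that pending_nonneg[of "B k" "\<sigma> k"] by force
  then show ?thesis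
    using completion_cost_nonneg[OF S(2) levels_nonneg] by (auto intro: le_cond_exp)
next
  case False
  define i where "i = chosen (levels \<sigma>) S"
  have S: "indep S" "S \<subseteq> {..<n}" "possible \<sigma>" using assms by auto
  have i: "i < n" "i \<notin> S" using chosen_unselected[OF S(2) False] by (auto simp: i_def)
  have "pending (B k) (\<sigma> k) = 0" if "k \<in> {..<n} - S - {i}" for k
    using assms that pending_nonneg[of "B k" "\<sigma> k"] by (force simp: i_def)
  then have "(\<Sum>k\<in>{..<n} - S. pending (B k) (\<sigma> k)) = (\<Sum>k\<in>{i}. pending (B k) (\<sigma> k))"
    using i by (intro sum.mono_neutral_right) auto
  also have "\<dots> \<le> levels \<sigma> i"
    using component_box.pending_le_level[OF component_box[OF i(1)], of "\<sigma> i"] assms i(1)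
      possible_nonneg[OF S(3) i(1)] by (simp add: levels_def)
  also have "\<dots> \<le> cond_exp (\<lambda>\<tau>. completion_cost (levels \<tau>) S) \<sigma>"
  proof (rule le_cond_exp, rule le_completion_cost)
    fix z k assume "k \<notin> S" "indep (insert k S)"
    then have "levels \<sigma> i \<le> levels \<sigma> k" "k < n"
      using chosen_minimal(2)[OF S(1) False, of k "levels \<sigma>"] indep_subset_carrier
      by (auto simp: i_def)
    then show "levels \<sigma> i \<le> levels (complete \<sigma> z) k"
      using level_le_levels_complete[OF assms, of k z] by (simp add: levels_def)
  qed (use S False levels_nonneg in \<open>auto simp: spanning_def\<close>)
  finally show ?thesis by simp
qed

lemma good_probe:
  assumes g: "good (\<sigma>, S)" and ns: "\<not> spanning S" and i: "i = chosen (levels \<sigma>) S"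
    and nf: "dom (\<sigma> i) \<noteq> box_parts i" and j: "j = committed_probe (B i) (\<sigma> i)"
    and v: "v \<in> set_pmf (component_dist (B i) j)"
  shows "good (\<sigma>(i := (\<sigma> i)(j \<mapsto> v)), S)"
proof -
  let ?\<sigma> = "\<sigma>(i := (\<sigma> i)(j \<mapsto> v))"
  have S: "indep S" "S \<subseteq> {..<n}" "possible \<sigma>" using g by auto
  have i': "i < n" "i \<notin> S" using chosen_unselected[OF S(2) ns] by (auto simp: i)
  interpret component_box "B i" using i' component_box by blast
  have track: "on_track (B i) (\<sigma> i)" using g i' by simp
  have jp: "j < num_components (B i)"
    using committed_probe_unprobed[of "\<sigma> i"] possible_dom[OF S(3) i'(1)] nf j by auto
  have "k = chosen (levels ?\<sigma>) S \<and> indep (insert k S)"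
    if k: "k \<in> {..<n} - S" "pending (B k) (?\<sigma> k) > 0" for k
  proof -
    have "k = i"
    proof (rule ccontr)
      assume "k \<noteq> i"
      then show False using good_pending[OF g k(1)] k(2) i by simp
    qed
    then have "level (B i) ((\<sigma> i)(j \<mapsto> v)) = level (B i) (\<sigma> i)"
      using k(2) by (intro level_step[OF track nf j]) simp
    \<comment> \<open>Equal level functions have the same chosen minimizer, also among ties.\<close>
    then have "levels ?\<sigma> = levels \<sigma>" by (auto simp: levels_def)
    then show ?thesis using \<open>k = i\<close> i chosen_minimal(1)[OF S(1) ns] by simp
  qed
  moreover have "on_track (B i) ((\<sigma> i)(j \<mapsto> v))"
    using on_track_step[OF track nf] j by simp
  ultimately show ?thesis
    using g possible_update[OF S(3) i'(1) jp v] by simp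
qed

text \<open>Nothing is lost here: the committed probe is optimal, so the pending gain grows on
  average by exactly its cost.\<close>

lemma upper_potential_probe:
  assumes g: "good (\<sigma>, S)" and ns: "\<not> spanning S" and i: "i = chosen (levels \<sigma>) S"
    and nf: "dom (\<sigma> i) \<noteq> box_parts i" and j: "j = committed_probe (B i) (\<sigma> i)"
  shows "probing_cost (B i) j + measure_pmf.expectation (component_dist (B i) j)
    (\<lambda>v. upper_potential (\<sigma>(i := (\<sigma> i)(j \<mapsto> v)), S)) = upper_potential (\<sigma>, S)"
proof -
  let ?\<sigma> = "\<lambda>v. \<sigma>(i := (\<sigma> i)(j \<mapsto> v))"
  let ?p = "component_dist (B i) j"
  have S: "indep S" "S \<subseteq> {..<n}" "possible \<sigma>" using g by auto
  have i': "i < n" "i \<notin> S" using chosen_unselected[OF S(2) ns] by (auto simp: i)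
  interpret component_box "B i" using i' component_box by blast
  have track: "on_track (B i) (\<sigma> i)" using g i' by simp
  have jp: "j \<in> box_parts i - dom (\<sigma> i)"
    using committed_probe_unprobed[of "\<sigma> i"] possible_dom[OF S(3) i'(1)] nf j by auto
  have int: "integrable (measure_pmf ?p) f" for f :: "real \<Rightarrow> real"
    using jp by (intro integrable_component) auto
  have split: "{..<n} - S = insert i ({..<n} - S - {i})" using i' by auto
  have "(\<Sum>k\<in>{..<n} - S. pending (B k) (?\<sigma> v k)) =
      pending (B i) ((\<sigma> i)(j \<mapsto> v)) + (\<Sum>k\<in>{..<n} - S - {i}. pending (B k) (\<sigma> k))" for v
    by (subst split, subst sum.insert) (auto intro!: sum.cong)
  moreover have "(\<Sum>k\<in>{..<n} - S. pending (B k) (\<sigma> k)) =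
      pending (B i) (\<sigma> i) + (\<Sum>k\<in>{..<n} - S - {i}. pending (B k) (\<sigma> k))"
    by (subst split, subst sum.insert) auto
  moreover have "\<sigma> i j = None" "j < num_components (B i)" using jp by auto
  ultimately show ?thesis
    using pending_step[OF track nf j] int
      cond_exp_probe[of i j \<sigma> "\<lambda>\<tau>. completion_cost (levels \<tau>) S"] i' by simp
qed

lemma good_select:
  assumes g: "good (\<sigma>, S)" and ns: "\<not> spanning S" and i: "i = chosen (levels \<sigma>) S"
  shows "good (\<sigma>, insert i S)"
proof -
  have S: "indep S" "S \<subseteq> {..<n}" "possible \<sigma>" using g by auto
  have i': "i < n" "i \<notin> S" using chosen_unselected[OF S(2) ns] by (auto simp: i)
  have "\<not> pending (B k) (\<sigma> k) > 0" if "k \<in> {..<n} - insert i S" for k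
    using good_pending(1)[OF g, of k] that i by blast
  moreover have "indep (insert i S)" unfolding i by (rule chosen_minimal(1)[OF S(1) ns])
  moreover have "on_track (B k) (\<sigma> k)" if "k < n" for k using g that by simp
  ultimately show ?thesis using S i' unfolding good.simps valid_config.simps by blast
qed

text \<open>The level of the fully probed box is final, and the current levels of the others bound
  their final ones from below. So the choice is greedy for the final levels too, in every
  completion.\<close>

lemma upper_potential_select:
  assumes g: "good (\<sigma>, S)" and ns: "\<not> spanning S" and i: "i = chosen (levels \<sigma>) S"
    and f: "dom (\<sigma> i) = box_parts i"
  shows "total (\<sigma> i) + upper_potential (\<sigma>, insert i S) \<le> upper_potential (\<sigma>, S)"
proof -
  have S: "indep S" "S \<subseteq> {..<n}" "possible \<sigma>" using g by auto
  have i': "i < n" "i \<notin> S" using chosen_unselected[OF S(2) ns] by (auto simp: i)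
  interpret component_box "B i" using i' component_box by blast
  have full: "levels (complete \<sigma> z) i = levels \<sigma> i" for z
    by (simp add: levels_def complete_full[of \<sigma> i, OF f])
  have "cond_exp (\<lambda>\<tau>. 1 * completion_cost (levels \<tau>) (insert i S) + levels \<sigma> i) \<sigma> \<le>
      cond_exp (\<lambda>\<tau>. completion_cost (levels \<tau>) S) \<sigma>"
  proof (rule cond_exp_mono)
    fix z
    have "levels (complete \<sigma> z) i + completion_cost (levels (complete \<sigma> z)) (insert i S)
        \<le> completion_cost (levels (complete \<sigma> z)) S"
    proof (rule completion_cost_greedy)
      fix k assume k: "k \<notin> S" "indep (insert k S)"
      then have "levels \<sigma> i \<le> levels \<sigma> k" "k < n"
        using chosen_minimal(2)[OF S(1) ns, of k "levels \<sigma>"] indep_subset_carrier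
        by (auto simp: i)
      then show "levels (complete \<sigma> z) i \<le> levels (complete \<sigma> z) k"
        using level_le_levels_complete[OF g, of k z] unfolding full by (simp add: levels_def)
    qed (use i' chosen_minimal(1)[OF S(1) ns] in \<open>simp_all add: i\<close>)
    then show "1 * completion_cost (levels (complete \<sigma> z)) (insert i S) + levels \<sigma> i
        \<le> completion_cost (levels (complete \<sigma> z)) S"
      unfolding full by simp
  qed
  moreover have "{..<n} - S = insert i ({..<n} - insert i S)" using i' by auto
  then have "(\<Sum>k\<in>{..<n} - S. pending (B k) (\<sigma> k)) =
      (\<Sum>k\<in>insert i ({..<n} - insert i S). pending (B k) (\<sigma> k))" by (rule arg_cong)
  then have "(\<Sum>k\<in>{..<n} - S. pending (B k) (\<sigma> k)) =
      pending (B i) (\<sigma> i) + (\<Sum>k\<in>{..<n} - insert i S. pending (B k) (\<sigma> k))" by simp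
  moreover have "total (\<sigma> i) = levels \<sigma> i - pending (B i) (\<sigma> i)"
    using pending_full[OF f] by (simp add: levels_def)
  ultimately show ?thesis unfolding cond_exp_affine by simp
qed

text \<open>Valid at every truncation \<open>N\<close>; the nonnegativity of the potential lets the
  real sums and expectations pass to \<open>ennreal\<close>.\<close>

lemma greedy_cost_le:
  assumes "good (current I h)"
  shows "cost_upto I greedy_policy N h \<le> ennreal (upper_potential (current I h))"
  using assms
proof (induction N arbitrary: h)
  case (Suc N h)
  obtain \<sigma> S where c: "current I h = (\<sigma>, S)" by fastforce
  have g: "good (\<sigma>, S)" using Suc.prems c by simp
  then have S: "indep S" "S \<subseteq> {..<n}" "possible \<sigma>" by auto
  show ?case
  proof (cases "finished I h")
    case False
    then have ns: "\<not> spanning S" using S by (auto simp: finished_iff c spanning_def)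
    define i where "i = chosen (levels \<sigma>) S"
    have i: "i < n" "i \<notin> S" using chosen_unselected[OF S(2) ns] by (auto simp: i_def)
    interpret component_box "B i" using i component_box by blast
    have IH: "cost_upto I greedy_policy N ((m, g) # h) \<le> ennreal (upper_potential g)" if "good g" for m g
      using Suc.IH[of "(m, g) # h"] that by (simp add: current_Cons)
    show ?thesis
    proof (cases "dom (\<sigma> i) = box_parts i")
      case True
      have t: "total (\<sigma> i) \<ge> 0"
        using possible_nonneg[OF S(3) i(1)] by (auto simp: total_def intro: sum_nonneg)
      have good': "good (\<sigma>, insert i S)" by (rule good_select[OF g ns i_def])
      have "cost_upto I greedy_policy (Suc N) h = ennreal (total (\<sigma> i)) +
          cost_upto I greedy_policy N ((Select i, (\<sigma>, insert i S)) # h)"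
        using False True greedy_policy_eq[OF c i_def] move_cost_Select[of \<sigma> i, OF True] by (simp add: c)
      also have "\<dots> \<le> ennreal (total (\<sigma> i)) + ennreal (upper_potential (\<sigma>, insert i S))"
        by (intro add_left_mono IH good')
      also have "\<dots> = ennreal (total (\<sigma> i) + upper_potential (\<sigma>, insert i S))"
        using t upper_potential_nonneg[OF good'] by (simp add: ennreal_plus)
      also have "\<dots> \<le> ennreal (upper_potential (\<sigma>, S))"
        by (intro ennreal_leI upper_potential_select[OF g ns i_def True])
      finally show ?thesis by (simp add: c)
    next
      case nf: False
      define j where "j = committed_probe (B i) (\<sigma> i)"
      let ?\<sigma> = "\<lambda>v. \<sigma>(i := (\<sigma> i)(j \<mapsto> v))"
      let ?p = "component_dist (B i) j"
      have jp: "j \<in> box_parts i"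
        using committed_probe_unprobed[of "\<sigma> i"] possible_dom[OF S(3) i(1)] nf j_def by auto
      have c0: "probing_cost (B i) j \<ge> 0" by (rule probing_cost_nonneg[OF jp])
      have good': "good (?\<sigma> v, S)" if "v \<in> set_pmf ?p" for v
        by (rule good_probe[OF g ns i_def nf j_def that])
      have nn: "AE v in measure_pmf ?p. 0 \<le> upper_potential (?\<sigma> v, S)"
        using good' upper_potential_nonneg by (simp add: AE_measure_pmf_iff del: upper_potential.simps good.simps)
      have pol: "greedy_policy h = return_pmf (Advance i j)"
        using greedy_policy_eq[OF c i_def] nf by (simp add: j_def)
      have "cost_upto I greedy_policy (Suc N) h = ennreal (probing_cost (B i) j) +
          (\<integral>\<^sup>+v. cost_upto I greedy_policy N ((Advance i j, (?\<sigma> v, S)) # h) \<partial>measure_pmf ?p)"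
        using False unfolding cost_upto.simps c pol
        by (simp del: move_cost.simps move_step.simps add: move_cost_Advance move_step_Advance)
      also have "\<dots> \<le> ennreal (probing_cost (B i) j) +
          (\<integral>\<^sup>+v. ennreal (upper_potential (?\<sigma> v, S)) \<partial>measure_pmf ?p)"
        using good' IH by (intro add_left_mono nn_integral_mono_AE)
          (simp add: AE_measure_pmf_iff del: upper_potential.simps good.simps)
      also have "(\<integral>\<^sup>+v. ennreal (upper_potential (?\<sigma> v, S)) \<partial>measure_pmf ?p) =
          ennreal (measure_pmf.expectation ?p (\<lambda>v. upper_potential (?\<sigma> v, S)))"
        by (intro nn_integral_eq_integral integrable_component jp nn)
      also have "ennreal (probing_cost (B i) j) + \<dots> = ennreal (probing_cost (B i) j +
          measure_pmf.expectation ?p (\<lambda>v. upper_potential (?\<sigma> v, S)))"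
        using c0 nn by (intro ennreal_plus[symmetric] integral_nonneg_AE)
      also have "\<dots> = ennreal (upper_potential (\<sigma>, S))"
        by (simp only: upper_potential_probe[OF g ns i_def nf j_def])
      finally show ?thesis by (simp add: c)
    qed
  qed simp
qed simp

lemma upper_bound:
  "committed_opt I commitment \<le>
    ennreal (cond_exp (\<lambda>\<tau>. completion_cost (levels \<tau>) {}) (\<lambda>_. Map.empty))"
proof -
  have pend: "pending (B k) Map.empty = 0" if "k < n" for k
    by (rule component_box.pending_empty[OF component_box[OF that]])
  have "good (current I [])"
    using component_box.on_track_empty[OF component_box] valid_config_history[OF histories.Nil]
    by (simp add: current_Nil indep_empty pend)
  then have "expected_cost I greedy_policy \<le> ennreal (upper_potential (current I []))"
    unfolding expected_cost_def by (intro SUP_least greedy_cost_le)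
  also have "upper_potential (current I []) =
      cond_exp (\<lambda>\<tau>. completion_cost (levels \<tau>) {}) (\<lambda>_. Map.empty)"
    by (simp add: current_Nil pend)
  finally show ?thesis
    unfolding committed_opt_def by (rule INF_lower2[OF greedy_policy_committing])
qed

section \<open>Comparison of the two bounds\<close>

lemma levels_le_paid_value:
  assumes "z \<in> set_pmf draws" "k < n" "possible \<sigma>"
  shows "levels (complete \<sigma> z) k \<le> 2 * paid_value (complete \<sigma> z) k"
proof -
  have "levels (complete \<sigma> z) k \<le> total (complete \<sigma> z k) + reserve (B k) (box_parts k)"
    unfolding levels_def using possible_nonneg[OF possible_complete[OF assms(3,1)] assms(2)]
    by (intro component_box.level_le[OF component_box[OF assms(2)]]) (auto simp: dom_complete)
  \<comment> \<open>A sum of two terms is at most twice their maximum; this is the factor 2 of the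
    theorem.\<close>
  then show ?thesis by (simp add: paid_value_def)
qed

lemma committed_opt_le: "committed_opt I commitment \<le> 2 * opt I"
proof -
  let ?\<sigma> = "\<lambda>_. Map.empty :: nat \<rightharpoonup> real"
  have "possible ?\<sigma>" by (simp add: possible_def additive_mdp_def)
  then have "cond_exp (\<lambda>\<tau>. completion_cost (levels \<tau>) {}) ?\<sigma> \<le>
      cond_exp (\<lambda>\<tau>. 2 * completion_cost (paid_value \<tau>) {} + 0) ?\<sigma>"
    using levels_le_paid_value by (intro cond_exp_mono) (auto intro: completion_cost_mono_scale)
  also have "\<dots> = 2 * cond_exp (\<lambda>\<tau>. completion_cost (paid_value \<tau>) {}) ?\<sigma>"
    unfolding cond_exp_affine by simp
  finally have "committed_opt I commitment \<le>
      ennreal (2 * cond_exp (\<lambda>\<tau>. completion_cost (paid_value \<tau>) {}) ?\<sigma>)"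
    using upper_bound ennreal_leI order_trans by blast
  also have "\<dots> = 2 * ennreal (cond_exp (\<lambda>\<tau>. completion_cost (paid_value \<tau>) {}) ?\<sigma>)"
    by (simp add: ennreal_mult')
  also have "\<dots> \<le> 2 * opt I"
    by (intro mult_left_mono lower_bound) auto
  finally show ?thesis .
qed

end

theorem theorem5:
  fixes n :: nat
    and B :: "nat \<Rightarrow> additive_box"
    and indep :: "nat set \<Rightarrow> bool"
  assumes "\<And>i. i < n \<Longrightarrow> valid_box (B i)"
    and "matroid {..<n} indep"
  shows "commitment_gap (matroid_apb n B indep) \<le> 2"
proof -
  interpret apb n indep B
    using assms by (simp add: apb_def apb_axioms_def)
  have "commitment_gap I \<le> committed_opt I commitment / opt I"
    unfolding commitment_gap_def by (rule INF_lower[OF commitment_in])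
  also have "\<dots> \<le> 2"
  \<comment> \<open>If the optimum is 0, so is the committed one by \<open>committed_opt_le\<close>,
    and \<open>0 / 0\<close> is 0 in \<open>ennreal\<close>.\<close>
  proof (cases "opt I = 0")
    case True
    then show ?thesis using committed_opt_le by simp
  next
    case False
    then show ?thesis
      using committed_opt_le by (intro divide_le_posI_ennreal) (auto simp: mult.commute zero_less_iff_neq_zero)
  qed
  finally show ?thesis .
qed

end
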